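(* Let $v$ be a Krull valuation of a field $K$ with value group $G_v$ and valuation ring $R_v$ having maximal ideal $M_v$. Let $\phi(x)\in R_v[x]$ be a monic polynomial of degree $m$ which is irreducible modulo $M_v$ (that is, its image $\bar{\phi}(x)$ in $(R_v/M_v)[x]$ is irreducible). Let $f(x)\in R_v[x]$ be a polynomial not divisible by $\phi(x)$. Assume that the $\phi$-Newton polygon of $f(x)$ with respect to $v$ has $\ell\geq 1$ edges with positive slopes, these slopes being $\lambda_j$, $1\leq j\leq \ell$. For $1\leq j\leq \ell$ let $d_j$ be the smallest positive integer such that $d_j\lambda_j\in G_v$. Then $f(x)$ has an irreducible factor over $K$ of degree at least $\max_{1\leq j\leq \ell}\{d_j m\}$.
   Context: $v$ is a Krull valuation of arbitrary rank, written additively; $G_v$ is a totally ordered abelian group, and its divisible closure carries the unique extending order. The Gaussian prolongation $v^x$ of $v$ to $K(x)$ is given on $K[x]$ by $v^x(\sum_i c_i x^i)=\min_i\{v(c_i)\}$, $c_i\in K$. $\phi$-expansion: for a monic polynomial $\phi(x)$, every $f(x)\in K[x]$ can be uniquely written as a finite sum $\sum_{i\ge 0}a_i(x)\phi(x)^i$ with $\deg a_i(x)<\deg\phi(x)$. $\phi$-Newton polygon: let $\phi(x)\in R_v[x]$ be monic with $\bar{\phi}(x)$ irreducible over $R_v/M_v$, and let $f(x)\in R_v[x]$ be not divisible by $\phi(x)$, with $\phi$-expansion $\sum_{i=0}^{n}a_i(x)\phi(x)^i$, $a_n(x)\neq 0$ (so $a_0(x)\ne 0$). For $0\le i\le n$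 with $a_{n-i}(x)\neq 0$ let $P_i=(i,v^x(a_{n-i}(x)))$. For distinct such pairs $P_i,P_j$ let $$\mu_{ij}=\frac{v^x(a_{n-j}(x))-v^x(a_{n-i}(x))}{j-i},$$ an element of the divisible closure of $G_v$. Let $i_1$ be the largest index with $0<i_1\le n$ such that $\mu_{0i_1}=\min\{\mu_{0j}: 0<j\le n,\ a_{n-j}(x)\ne 0\}$. If $i_1<n$, let $i_2$ be the largest index with $i_1<i_2\le n$ such that $\mu_{i_1i_2}=\min\{\mu_{i_1j}: i_1<j\le n,\ a_{n-j}(x)\neq 0\}$. Continue in this way until an index $i_k=n$ is reached. The $\phi$-Newton polygon of $f(x)$ is then said to have $k$ edges, whose slopes are $\mu_{0i_1},\mu_{i_1i_2},\dots,\mu_{i_{k-1}i_k}$ (these are strictly increasing). Some of these slopes may be non-positive; the $\lambda_j$ are the slopes of those edges whose slope is positive. *)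

theory Defs
  imports
    "HOL-Algebra.UnivPoly"
    "HOL-Algebra.QuotRing"
    "HOL-Algebra.Ring_Divisibility"
    "HOL-Computational_Algebra.Polynomial_Factorial"
begin

section \<open>The divisible closure of an ordered abelian group\<close>

primrec nsmul :: "nat \<Rightarrow> 'g::comm_monoid_add \<Rightarrow> 'g" where
  "nsmul 0 a = 0"
| "nsmul (Suc n) a = a + nsmul n a"

lemma nsmul_zero [simp]: "nsmul n 0 = 0"
  by (induction n) auto

lemma nsmul_add: "nsmul n (a + b) = nsmul n a + nsmul n b"
  by (induction n) (auto simp: algebra_simps)

lemma nsmul_plus: "nsmul (m + n) a = nsmul m a + nsmul n a"
  by (induction m) (auto simp: algebra_simps)

lemma nsmul_nsmul: "nsmul m (nsmul n a) = nsmul (m * n) a"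
  by (induction m) (auto simp: nsmul_plus)

lemma nsmul_commute: "nsmul m (nsmul n a) = nsmul n (nsmul m a)"
  by (simp add: nsmul_nsmul mult.commute)

lemma nsmul_swap:
  assumes "nsmul c a = nsmul b a'"
  shows "nsmul (c * d) (nsmul e a) = nsmul (b * e) (nsmul d a')"
proof -
  have "nsmul (c * d) (nsmul e a) = nsmul (d * e) (nsmul c a)"
    by (simp add: nsmul_nsmul ac_simps)
  also have "\<dots> = nsmul (b * e) (nsmul d a')"
    unfolding assms by (simp add: nsmul_nsmul ac_simps)
  finally show ?thesis .
qed

lemma nsmul_uminus: "nsmul n (- a) = - nsmul n (a :: 'g::ab_group_add)"
  by (induction n) auto

lemma nsmul_mono: "a \<le> b \<Longrightarrow> nsmul n a \<le> nsmul n (b :: 'g::linordered_ab_group_add)"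
  by (induction n) (auto intro: add_mono)

lemma nsmul_strict_mono:
  "a < b \<Longrightarrow> 0 < n \<Longrightarrow> nsmul n a < nsmul n (b :: 'g::linordered_ab_group_add)"
proof (induction n)
  case (Suc n)
  then show ?case
    using nsmul_mono[of a b n] by (auto intro: add_less_le_mono)
qed auto

lemma nsmul_le_iff:
  "0 < n \<Longrightarrow> nsmul n a \<le> nsmul n b \<longleftrightarrow> a \<le> (b :: 'g::linordered_ab_group_add)"
  by (meson nsmul_mono nsmul_strict_mono not_le)

lemma nsmul_eq_iff:
  "0 < n \<Longrightarrow> nsmul n a = nsmul n b \<longleftrightarrow> a = (b :: 'g::linordered_ab_group_add)"
  by (metis nsmul_le_iff order_antisym order_refl)

text \<open>The pair \<open>(a, n)\<close> with \<open>0 < n\<close> represents \<open>a / n\<close>.\<close>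

definition divrel :: "'g::linordered_ab_group_add \<times> nat \<Rightarrow> 'g \<times> nat \<Rightarrow> bool" where
  "divrel x y \<longleftrightarrow>
     0 < snd x \<and> 0 < snd y \<and> nsmul (snd y) (fst x) = nsmul (snd x) (fst y)"

lemma part_equivp_divrel:
  "part_equivp (divrel :: 'g::linordered_ab_group_add \<times> nat \<Rightarrow> _)"
proof (rule part_equivpI)
  show "\<exists>x :: 'g \<times> nat. divrel x x"
    by (rule exI[of _ "(0, 1)"]) (simp add: divrel_def)
  show "symp (divrel :: 'g \<times> nat \<Rightarrow> _)"
    by (auto simp: symp_def divrel_def)
  show "transp (divrel :: 'g \<times> nat \<Rightarrow> _)"
  proof (rule transpI)
    fix x y z :: "'g \<times> nat"
    assume xy: "divrel x y" and yz: "divrel y z"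
    have "nsmul (snd y) (nsmul (snd z) (fst x)) = nsmul (snd z) (nsmul (snd x) (fst y))"
      using xy by (metis divrel_def nsmul_commute)
    also have "\<dots> = nsmul (snd x) (nsmul (snd y) (fst z))"
      using yz by (metis divrel_def nsmul_commute)
    also have "\<dots> = nsmul (snd y) (nsmul (snd x) (fst z))"
      by (rule nsmul_commute)
    finally show "divrel x z"
      using xy yz by (auto simp: divrel_def nsmul_eq_iff)
  qed
qed

quotient_type (overloaded) 'g divcl = "'g::linordered_ab_group_add \<times> nat" / partial: divrel
  by (rule part_equivp_divrel)

lemma divrel_cross:
  assumes "divrel x x'" "divrel y y'"
  shows "nsmul (snd y) (fst x) \<le> nsmul (snd x) (fst y) \<longleftrightarrow>
         nsmul (snd y') (fst x') \<le> nsmul (snd x') (fst y')"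
proof -
  have pos: "0 < snd x" "0 < snd y" "0 < snd x'" "0 < snd y'"
    and ex: "nsmul (snd x') (fst x) = nsmul (snd x) (fst x')"
    and ey: "nsmul (snd y') (fst y) = nsmul (snd y) (fst y')"
    using assms by (auto simp: divrel_def)
  have l: "nsmul (snd x' * snd y') (nsmul (snd y) (fst x)) =
        nsmul (snd x * snd y) (nsmul (snd y') (fst x'))"
    using ex by (rule nsmul_swap)
  have r: "nsmul (snd x' * snd y') (nsmul (snd x) (fst y)) =
        nsmul (snd x * snd y) (nsmul (snd x') (fst y'))"
    using nsmul_swap[OF ey, of "snd x'" "snd x"] by (simp add: mult.commute)
  have "nsmul (snd y) (fst x) \<le> nsmul (snd x) (fst y) \<longleftrightarrow>
        nsmul (snd x' * snd y') (nsmul (snd y) (fst x)) \<le>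
        nsmul (snd x' * snd y') (nsmul (snd x) (fst y))"
    using pos by (simp add: nsmul_le_iff)
  also have "\<dots> \<longleftrightarrow> nsmul (snd y') (fst x') \<le> nsmul (snd x') (fst y')"
    unfolding l r using pos by (simp add: nsmul_le_iff)
  finally show ?thesis .
qed

instantiation divcl :: (linordered_ab_group_add) linordered_ab_group_add
begin

lift_definition zero_divcl :: "'a divcl" is "(0, 1)"
  by (simp add: divrel_def)

lift_definition plus_divcl :: "'a divcl \<Rightarrow> 'a divcl \<Rightarrow> 'a divcl"
  is "\<lambda>x y. (nsmul (snd y) (fst x) + nsmul (snd x) (fst y), snd x * snd y)"
proof -
  fix x x' y y' :: "'a \<times> nat"
  assume "divrel x x'" "divrel y y'"
  then have pos: "0 < snd x" "0 < snd y" "0 < snd x'" "0 < snd y'"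
    and ex: "nsmul (snd x') (fst x) = nsmul (snd x) (fst x')"
    and ey: "nsmul (snd y') (fst y) = nsmul (snd y) (fst y')"
    by (auto simp: divrel_def)
  have l: "nsmul (snd x' * snd y') (nsmul (snd y) (fst x)) =
        nsmul (snd x * snd y) (nsmul (snd y') (fst x'))"
    using ex by (rule nsmul_swap)
  have r: "nsmul (snd x' * snd y') (nsmul (snd x) (fst y)) =
        nsmul (snd x * snd y) (nsmul (snd x') (fst y'))"
    using nsmul_swap[OF ey, of "snd x'" "snd x"] by (simp add: mult.commute)
  show "divrel (nsmul (snd y) (fst x) + nsmul (snd x) (fst y), snd x * snd y)
          (nsmul (snd y') (fst x') + nsmul (snd x') (fst y'), snd x' * snd y')"
    using pos l r by (simp add: divrel_def nsmul_add)
qed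

lift_definition uminus_divcl :: "'a divcl \<Rightarrow> 'a divcl" is "\<lambda>x. (- fst x, snd x)"
  by (simp add: divrel_def nsmul_uminus)

definition minus_divcl :: "'a divcl \<Rightarrow> 'a divcl \<Rightarrow> 'a divcl" where
  "minus_divcl x y = x + - y"

lift_definition less_eq_divcl :: "'a divcl \<Rightarrow> 'a divcl \<Rightarrow> bool"
  is "\<lambda>x y. nsmul (snd y) (fst x) \<le> nsmul (snd x) (fst y)"
  by (rule divrel_cross)

definition less_divcl :: "'a divcl \<Rightarrow> 'a divcl \<Rightarrow> bool" where
  "less_divcl x y \<longleftrightarrow> x \<le> y \<and> \<not> y \<le> x"

instance
proof
  fix a b c :: "'a divcl"
  show "a + b + c = a + (b + c)"
    by transfer (simp add: divrel_def nsmul_add nsmul_nsmul ac_simps)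
  show "a + b = b + a"
    by transfer (simp add: divrel_def ac_simps)
  show "0 + a = a"
    by transfer (simp add: divrel_def)
  show "- a + a = 0"
    by transfer (simp add: divrel_def nsmul_uminus)
  show "a - b = a + - b"
    by (rule minus_divcl_def)
  show "a < b \<longleftrightarrow> a \<le> b \<and> \<not> b \<le> a"
    by (rule less_divcl_def)
  show "a \<le> a"
    by transfer simp
  show "a \<le> b \<or> b \<le> a"
    by transfer auto
  show "a \<le> b \<Longrightarrow> b \<le> a \<Longrightarrow> a = b"
    by transfer (simp add: divrel_def)
  show "a \<le> c" if "a \<le> b" "b \<le> c"
    using that
  proof transfer
    fix x y z :: "'a \<times> nat"
    assume xyz: "divrel x x" "divrel y y" "divrel z z"
      and xy: "nsmul (snd y) (fst x) \<le> nsmul (snd x) (fst y)"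
      and yz: "nsmul (snd z) (fst y) \<le> nsmul (snd y) (fst z)"
    have "nsmul (snd y) (nsmul (snd z) (fst x)) \<le> nsmul (snd z) (nsmul (snd x) (fst y))"
      using nsmul_mono[OF xy, of "snd z"] by (simp add: nsmul_commute)
    also have "\<dots> \<le> nsmul (snd y) (nsmul (snd x) (fst z))"
      using nsmul_mono[OF yz, of "snd x"] by (metis nsmul_commute)
    finally show "nsmul (snd z) (fst x) \<le> nsmul (snd x) (fst z)"
      using xyz by (simp add: divrel_def nsmul_le_iff)
  qed
  show "c + a \<le> c + b" if "a \<le> b"
    using that
  proof transfer
    fix x y z :: "'a \<times> nat"
    assume xyz: "divrel x x" "divrel y y" "divrel z z"
      and xy: "nsmul (snd y) (fst x) \<le> nsmul (snd x) (fst y)"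
    have "nsmul (snd z * snd z) (nsmul (snd y) (fst x)) \<le>
          nsmul (snd z * snd z) (nsmul (snd x) (fst y))"
      by (rule nsmul_mono[OF xy])
    then show "nsmul (snd (nsmul (snd y) (fst z) + nsmul (snd z) (fst y), snd z * snd y))
           (fst (nsmul (snd x) (fst z) + nsmul (snd z) (fst x), snd z * snd x))
       \<le> nsmul (snd (nsmul (snd x) (fst z) + nsmul (snd z) (fst x), snd z * snd x))
           (fst (nsmul (snd y) (fst z) + nsmul (snd z) (fst y), snd z * snd y))"
      by (simp add: nsmul_add nsmul_nsmul ac_simps)
  qed
qed

end

text \<open>\<open>divcl_frac a n\<close> is the element \<open>a / n\<close>; the second component is only meaningful for
  \<open>0 < n\<close> (as for \<^const>\<open>Fract\<close>, \<open>n = 0\<close> gives \<open>0\<close>).\<close>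

lift_definition divcl_frac :: "'g::linordered_ab_group_add \<Rightarrow> nat \<Rightarrow> 'g divcl"
  is "\<lambda>a n. if n = 0 then (0, 1) else (a, n)"
  by (simp add: divrel_def)

definition divcl_embed :: "'g::linordered_ab_group_add \<Rightarrow> 'g divcl" where
  "divcl_embed a = divcl_frac a 1"

lemma divcl_embed_add: "divcl_embed (a + b) = divcl_embed a + divcl_embed b"
  unfolding divcl_embed_def by transfer (simp add: divrel_def)

lemma divcl_embed_le_iff: "divcl_embed a \<le> divcl_embed b \<longleftrightarrow> a \<le> b"
  unfolding divcl_embed_def by transfer simp

lemma divcl_cases: obtains a n where "0 < n" "x = divcl_frac a n"
proof -
  have "\<exists>a n. 0 < n \<and> x = divcl_frac a n"
  proof transfer
    fix x :: "'a \<times> nat"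
    assume "divrel x x"
    then show "\<exists>a n. 0 < n \<and> divrel x (if n = 0 then (0, 1) else (a, n))"
      by (intro exI[of _ "fst x"] exI[of _ "snd x"]) (auto simp: divrel_def)
  qed
  then show ?thesis using that by blast
qed

lemma divcl_frac_add_same:
  "0 < n \<Longrightarrow> divcl_frac a n + divcl_frac b n = divcl_frac (a + b) n"
  by transfer (simp add: divrel_def nsmul_add nsmul_nsmul)

lemma nsmul_divcl_frac:
  assumes "0 < n" shows "nsmul k (divcl_frac a n) = divcl_frac (nsmul k a) n"
proof (induction k)
  case 0
  show ?case by (simp, transfer) (simp add: divrel_def)
next
  case (Suc k)
  then show ?case using assms by (simp add: divcl_frac_add_same)
qed

lemma nsmul_divcl_frac_cancel: "0 < n \<Longrightarrow> nsmul n (divcl_frac a n) = divcl_embed a"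
  unfolding divcl_embed_def
  by (simp add: nsmul_divcl_frac, transfer) (simp add: divrel_def)


section \<open>Krull valuations\<close>

text \<open>The value at \<open>0\<close> is \<open>\<infinity>\<close> by convention; it is not represented, and \<open>v 0\<close> is a junk value
  that no definition below depends on. The rank is arbitrary. The value group need not be all of
  \<open>'g\<close>.\<close>

locale krull_valuation =
  fixes v :: "'k::field \<Rightarrow> 'g::linordered_ab_group_add"
  assumes v_mult: "x \<noteq> 0 \<Longrightarrow> y \<noteq> 0 \<Longrightarrow> v (x * y) = v x + v y"
    and v_add: "x \<noteq> 0 \<Longrightarrow> y \<noteq> 0 \<Longrightarrow> x + y \<noteq> 0 \<Longrightarrow> min (v x) (v y) \<le> v (x + y)"

definition value_group :: "('k::field \<Rightarrow> 'g) \<Rightarrow> 'g set" where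
  "value_group v = v ` (UNIV - {0})"

definition valuation_ring :: "('k::field \<Rightarrow> 'g::linordered_ab_group_add) \<Rightarrow> 'k ring" where
  "valuation_ring v =
     \<lparr>carrier = {x. x = 0 \<or> 0 \<le> v x}, mult = (*), one = 1, zero = 0, add = (+)\<rparr>"

definition valuation_ideal :: "('k::field \<Rightarrow> 'g::linordered_ab_group_add) \<Rightarrow> 'k set" where
  "valuation_ideal v = {x. x = 0 \<or> 0 < v x}"

definition residue_field :: "('k::field \<Rightarrow> 'g::linordered_ab_group_add) \<Rightarrow> 'k set ring" where
  "residue_field v = valuation_ring v Quot valuation_ideal v"

definition integral_poly :: "('k::field \<Rightarrow> 'g::linordered_ab_group_add) \<Rightarrow> 'k poly \<Rightarrow> bool" where
  "integral_poly v p \<longleftrightarrow> (\<forall>i. poly.coeff p i \<in> carrier (valuation_ring v))"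

text \<open>The image of \<open>p\<close> in the ring \<open>UP (residue_field v)\<close>, whose elements are coefficient
  sequences.\<close>

definition reduce_poly ::
  "('k::field \<Rightarrow> 'g::linordered_ab_group_add) \<Rightarrow> 'k poly \<Rightarrow> nat \<Rightarrow> 'k set" where
  "reduce_poly v p = (\<lambda>i. valuation_ideal v +>\<^bsub>valuation_ring v\<^esub> poly.coeff p i)"

text \<open>The Gaussian prolongation on nonzero polynomials (again, \<open>v\<^sup>x 0 = \<infinity>\<close> is not represented).\<close>

definition gauss_val :: "('k::field \<Rightarrow> 'g::linordered_ab_group_add) \<Rightarrow> 'k poly \<Rightarrow> 'g" where
  "gauss_val v p = Min ((\<lambda>i. v (poly.coeff p i)) ` {i. poly.coeff p i \<noteq> 0})"


section \<open>Expansions and Newton polygons\<close>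

definition is_phi_expansion :: "'k::field poly \<Rightarrow> 'k poly \<Rightarrow> (nat \<Rightarrow> 'k poly) \<Rightarrow> bool" where
  "is_phi_expansion \<phi> f a \<longleftrightarrow>
     finite {i. a i \<noteq> 0} \<and> (\<forall>i. a i \<noteq> 0 \<longrightarrow> Polynomial.degree (a i) < Polynomial.degree \<phi>) \<and>
     f = (\<Sum>i | a i \<noteq> 0. a i * \<phi> ^ i)"

definition phi_coeff :: "'k::field poly \<Rightarrow> 'k poly \<Rightarrow> nat \<Rightarrow> 'k poly" where
  "phi_coeff \<phi> f = (THE a. is_phi_expansion \<phi> f a)"

lemma is_phi_expansion_Suc:
  assumes deg: "0 < Polynomial.degree \<phi>"
  shows "is_phi_expansion \<phi> f a \<longleftrightarrow>
    a 0 = f mod \<phi> \<and> is_phi_expansion \<phi> (f div \<phi>) (\<lambda>i. a (Suc i))"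
    (is "?L \<longleftrightarrow> ?R")
proof -
  have phi0: "\<phi> \<noteq> 0"
    using deg by auto
  let ?b = "\<lambda>i. a (Suc i)"
  have S: "{i. a i \<noteq> 0} \<subseteq> insert 0 (Suc ` {i. ?b i \<noteq> 0})"
  proof
    fix i assume "i \<in> {i. a i \<noteq> 0}"
    then show "i \<in> insert 0 (Suc ` {i. ?b i \<noteq> 0})" by (cases i) auto
  qed
  have fin: "finite {i. a i \<noteq> 0} \<longleftrightarrow> finite {i. ?b i \<noteq> 0}"
  proof
    assume "finite {i. a i \<noteq> 0}"
    moreover have "Suc ` {i. ?b i \<noteq> 0} \<subseteq> {i. a i \<noteq> 0}" by auto
    ultimately show "finite {i. ?b i \<noteq> 0}"
      by (meson finite_imageD finite_subset inj_Suc inj_on_subset subset_UNIV)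
  next
    assume "finite {i. ?b i \<noteq> 0}"
    then show "finite {i. a i \<noteq> 0}"
      using S finite_subset by blast
  qed
  have sum: "(\<Sum>i | a i \<noteq> 0. a i * \<phi> ^ i) = a 0 + \<phi> * (\<Sum>i | ?b i \<noteq> 0. ?b i * \<phi> ^ i)"
    if "finite {i. ?b i \<noteq> 0}"
  proof -
    have "(\<Sum>i | a i \<noteq> 0. a i * \<phi> ^ i) = (\<Sum>i\<in>insert 0 (Suc ` {i. ?b i \<noteq> 0}). a i * \<phi> ^ i)"
      by (rule sum.mono_neutral_left) (use that S in auto)
    also have "\<dots> = a 0 + (\<Sum>i | ?b i \<noteq> 0. ?b i * \<phi> ^ Suc i)"
      using that by (subst sum.insert) (auto simp: sum.reindex)
    also have "\<dots> = a 0 + \<phi> * (\<Sum>i | ?b i \<noteq> 0. ?b i * \<phi> ^ i)"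
      by (simp add: sum_distrib_left mult_ac)
    finally show ?thesis .
  qed
  show ?thesis
  proof
    assume L: ?L
    then have finb: "finite {i. ?b i \<noteq> 0}"
      using fin by (auto simp: is_phi_expansion_def)
    define q where "q = (\<Sum>i | ?b i \<noteq> 0. ?b i * \<phi> ^ i)"
    have f: "f = a 0 + \<phi> * q"
      using L sum[OF finb] by (simp add: is_phi_expansion_def q_def)
    have a0: "a 0 = 0 \<or> Polynomial.degree (a 0) < Polynomial.degree \<phi>"
      using L by (auto simp: is_phi_expansion_def)
    then have "a 0 mod \<phi> = a 0" "a 0 div \<phi> = 0"
      by (auto simp: mod_poly_less div_poly_less)
    then have "f mod \<phi> = a 0" "f div \<phi> = q"
      using phi0 by (simp_all add: f)
    then show ?R
      using L finb by (auto simp: is_phi_expansion_def q_def)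
  next
    assume R: ?R
    then have finb: "finite {i. ?b i \<noteq> 0}"
      by (auto simp: is_phi_expansion_def)
    have "f = a 0 + \<phi> * (f div \<phi>)"
      using R by simp
    also have "\<dots> = (\<Sum>i | a i \<noteq> 0. a i * \<phi> ^ i)"
      using R sum[OF finb] by (simp add: is_phi_expansion_def)
    finally have "f = (\<Sum>i | a i \<noteq> 0. a i * \<phi> ^ i)" .
    moreover have "Polynomial.degree (a i) < Polynomial.degree \<phi>" if "a i \<noteq> 0" for i
    proof (cases i)
      case 0
      then show ?thesis
        using R that degree_mod_less[OF phi0, of f] by auto
    next
      case (Suc j)
      then show ?thesis
        using R that by (auto simp: is_phi_expansion_def)
    qed
    ultimately show ?L
      using fin finb by (auto simp: is_phi_expansion_def)
  qed
qed

lemma phi_expansion_ex1: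
  assumes deg: "0 < Polynomial.degree \<phi>"
  shows "\<exists>!a. is_phi_expansion \<phi> f a"
proof (induction "Polynomial.degree f" arbitrary: f rule: less_induct)
  case less
  have zero: "is_phi_expansion \<phi> 0 a \<longleftrightarrow> a = (\<lambda>_. 0)" for a
  proof
    assume a: "is_phi_expansion \<phi> 0 a"
    have "is_phi_expansion \<phi> 0 a \<Longrightarrow> a i = 0" for i
    proof (induction i arbitrary: a)
      case 0
      then show ?case
        using is_phi_expansion_Suc[OF deg, of 0 a] by simp
    next
      case (Suc i)
      show ?case
        using Suc.IH[of "\<lambda>i. a (Suc i)"] Suc.prems
        by (simp add: is_phi_expansion_Suc[OF deg, of 0 a])
    qed
    with a show "a = (\<lambda>_. 0)" by blast
  qed (simp add: is_phi_expansion_def)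
  have "\<exists>!b. is_phi_expansion \<phi> (f div \<phi>) b"
  proof (cases "Polynomial.degree f < Polynomial.degree \<phi>")
    case True
    then show ?thesis by (simp add: div_poly_less zero)
  next
    case False
    then have "Polynomial.degree (f div \<phi>) < Polynomial.degree f"
      using deg by (auto intro: degree_div_less)
    then show ?thesis by (rule less)
  qed
  then obtain b where b: "is_phi_expansion \<phi> (f div \<phi>) b"
    and uniq: "\<And>c. is_phi_expansion \<phi> (f div \<phi>) c \<Longrightarrow> c = b" by blast
  show ?case
  proof (rule ex1I)
    show "is_phi_expansion \<phi> f (case_nat (f mod \<phi>) b)"
      using b by (subst is_phi_expansion_Suc[OF deg]) simp
    fix c assume "is_phi_expansion \<phi> f c"
    then have c0: "c 0 = f mod \<phi>" and "is_phi_expansion \<phi> (f div \<phi>) (\<lambda>i. c (Suc i))"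
      using is_phi_expansion_Suc[OF deg, of f c] by simp_all
    then have cS: "(\<lambda>i. c (Suc i)) = b"
      using uniq by blast
    show "c = case_nat (f mod \<phi>) b"
      using c0 cS by (auto simp: fun_eq_iff split: nat.split)
  qed
qed

definition phi_length :: "'k::field poly \<Rightarrow> 'k poly \<Rightarrow> nat" where
  "phi_length \<phi> f = Max {i. phi_coeff \<phi> f i \<noteq> 0}"

text \<open>The abscissae of the points \<open>P\<^sub>i\<close>, and their ordinates.\<close>

definition np_indices :: "'k::field poly \<Rightarrow> 'k poly \<Rightarrow> nat set" where
  "np_indices \<phi> f = {i. i \<le> phi_length \<phi> f \<and> phi_coeff \<phi> f (phi_length \<phi> f - i) \<noteq> 0}"

definition np_height ::
  "('k::field \<Rightarrow> 'g::linordered_ab_group_add) \<Rightarrow> 'k poly \<Rightarrow> 'k poly \<Rightarrow> nat \<Rightarrow> 'g" where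
  "np_height v \<phi> f i = gauss_val v (phi_coeff \<phi> f (phi_length \<phi> f - i))"

text \<open>The slope of the line through \<open>P\<^sub>i\<close> and \<open>P\<^sub>j\<close>, used for \<open>i < j\<close> only.\<close>

definition np_mu ::
  "('k::field \<Rightarrow> 'g::linordered_ab_group_add) \<Rightarrow> 'k poly \<Rightarrow> 'k poly \<Rightarrow> nat \<Rightarrow> nat \<Rightarrow> 'g divcl" where
  "np_mu v \<phi> f i j = divcl_frac (np_height v \<phi> f j - np_height v \<phi> f i) (j - i)"

definition np_next ::
  "('k::field \<Rightarrow> 'g::linordered_ab_group_add) \<Rightarrow> 'k poly \<Rightarrow> 'k poly \<Rightarrow> nat \<Rightarrow> nat" where
  "np_next v \<phi> f i =
     Max {j \<in> np_indices \<phi> f. i < j \<and>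
            np_mu v \<phi> f i j = Min (np_mu v \<phi> f i ` {j' \<in> np_indices \<phi> f. i < j'})}"

definition np_vertex ::
  "('k::field \<Rightarrow> 'g::linordered_ab_group_add) \<Rightarrow> 'k poly \<Rightarrow> 'k poly \<Rightarrow> nat \<Rightarrow> nat" where
  "np_vertex v \<phi> f t = (np_next v \<phi> f ^^ t) 0"

text \<open>When \<open>\<phi>\<close> does not divide \<open>f\<close>, the last index \<open>phi_length \<phi> f\<close> belongs to
  \<^const>\<open>np_indices\<close>, so it is reached after finitely many steps; later iterates are junk.\<close>

definition np_edges ::
  "('k::field \<Rightarrow> 'g::linordered_ab_group_add) \<Rightarrow> 'k poly \<Rightarrow> 'k poly \<Rightarrow> nat" where
  "np_edges v \<phi> f = (LEAST k. np_vertex v \<phi> f k = phi_length \<phi> f)"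

definition np_slopes ::
  "('k::field \<Rightarrow> 'g::linordered_ab_group_add) \<Rightarrow> 'k poly \<Rightarrow> 'k poly \<Rightarrow> 'g divcl list" where
  "np_slopes v \<phi> f =
     map (\<lambda>t. np_mu v \<phi> f (np_vertex v \<phi> f t) (np_vertex v \<phi> f (Suc t))) [0..<np_edges v \<phi> f]"

definition np_positive_slopes ::
  "('k::field \<Rightarrow> 'g::linordered_ab_group_add) \<Rightarrow> 'k poly \<Rightarrow> 'k poly \<Rightarrow> 'g divcl list" where
  "np_positive_slopes v \<phi> f = filter (\<lambda>s. 0 < s) (np_slopes v \<phi> f)"

end

theory Submission
  imports Defs
begin

text \<open>
  Fix a slope \<open>\<mu> > 0\<close> and weigh the term \<open>a \<phi>\<^sup>i\<close> of a \<open>\<phi>\<close>-expansion by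
  \<open>v\<^sup>x(a) + i \<mu>\<close>. For a nonzero polynomial \<open>f\<close> let \<open>s \<le> S\<close> be the least and the greatest
  exponent at which the minimal weight occurs. An edge of slope \<open>\<mu>\<close> of the \<open>\<phi>\<close>-Newton polygon
  spans a line lying below all the points of the polygon, so its two end points both have minimal
  weight and \<open>s < S\<close> (\<open>np_slope_face\<close>).

  The heart of the matter is that \<open>s\<close> and \<open>S\<close> are additive: if \<open>f\<close> has the extremal exponents
  \<open>(s, S)\<close> and \<open>g\<close> has \<open>(s', S')\<close>, then \<open>f g\<close> has \<open>(s + s', S + S')\<close>
  (\<open>face_mult\<close>). When two coefficients \<open>a\<close>, \<open>b\<close> of degree below \<open>deg \<phi>\<close> are multiplied, one
  gets \<open>a b = c + d \<phi>\<close>. The carry \<open>d\<close> has value at least \<open>v\<^sup>x(a) + v\<^sup>x(b)\<close> and sits one power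
  of \<open>\<phi>\<close> higher, so it has too large a weight to matter, because \<open>\<mu> > 0\<close>. The remainder \<open>c\<close> has
  value exactly \<open>v\<^sup>x(a) + v\<^sup>x(b)\<close>: after scaling both values to \<open>0\<close>, a larger value of \<open>c\<close>
  would make the reduction of \<open>\<phi>\<close> divide the product of two nonzero polynomials of smaller degree,
  although it is irreducible and hence prime over the residue field (\<open>mult_mod_phi_exact\<close>).
  So the extremal terms of \<open>f g\<close> come from the products of the extremal terms of \<open>f\<close> and \<open>g\<close>, as
  for ordinary Newton polygons, and the carries cannot cancel them.

  By additivity, if \<open>s < S\<close> holds for \<open>f\<close>, it holds for some irreducible factor \<open>g\<close> of \<open>f\<close>
  (\<open>irreducible_factor_with_face\<close>). For this factor the two extremal weights
  are equal, so \<open>(S - s) \<mu>\<close> is a difference of two elements of the value group. The least positive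
  \<open>d\<close> with \<open>d \<mu>\<close> in the value group is therefore at most \<open>S - s\<close>, and
  \<open>deg g \<ge> S deg \<phi> \<ge> d deg \<phi>\<close> because a term with \<open>\<phi>\<^sup>S\<close> occurs in \<open>g\<close>. Applying this to the
  slope with the largest \<open>d\<close> gives the theorem.
\<close>

section \<open>Balls of a Krull valuation\<close>

lemma divcl_embed_zero [simp]: "divcl_embed 0 = 0"
  using divcl_embed_add[of 0 0] by simp

lemma divcl_embed_uminus: "divcl_embed (- a) = - divcl_embed a"
  using divcl_embed_add[of a "- a"] by (simp add: eq_neg_iff_add_eq_0 add.commute)

lemma divcl_embed_diff: "divcl_embed (a - b) = divcl_embed a - divcl_embed b"
  using divcl_embed_add[of a "- b"] by (simp add: divcl_embed_uminus)

lemma divcl_embed_less_iff: "divcl_embed a < divcl_embed b \<longleftrightarrow> a < b"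
  by (simp add: divcl_embed_le_iff flip: not_le)

text \<open>
  The estimates below come in a weak and a strict version, which differ only in the subgroup of \<open>K\<close>
  to which the coefficients belong; statements about an arbitrary additive subgroup serve for both.
\<close>

definition subgroup_plus :: "'a::ab_group_add set \<Rightarrow> bool" where
  "subgroup_plus A \<longleftrightarrow> 0 \<in> A \<and> (\<forall>x\<in>A. \<forall>y\<in>A. x - y \<in> A)"

lemma subgroup_plus_zero: "subgroup_plus A \<Longrightarrow> 0 \<in> A"
  by (simp add: subgroup_plus_def)

lemma subgroup_plus_diff: "subgroup_plus A \<Longrightarrow> x \<in> A \<Longrightarrow> y \<in> A \<Longrightarrow> x - y \<in> A"
  by (simp add: subgroup_plus_def)

lemma subgroup_plus_add: "subgroup_plus A \<Longrightarrow> x \<in> A \<Longrightarrow> y \<in> A \<Longrightarrow> x + y \<in> A"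
  using subgroup_plus_diff[of A x "0 - y"] subgroup_plus_diff[of A 0 y]
  by (simp add: subgroup_plus_zero)

lemma subgroup_plus_sum:
  assumes "subgroup_plus A" "\<And>i. i \<in> I \<Longrightarrow> f i \<in> A"
  shows "sum f I \<in> A"
  using assms(2)
  by (induction I rule: infinite_finite_induct)
    (auto intro: subgroup_plus_add subgroup_plus_zero assms(1))

definition poly_over :: "'a::zero set \<Rightarrow> 'a poly set" where
  "poly_over A = {p. \<forall>i. poly.coeff p i \<in> A}"

lemma poly_over_mono: "A \<subseteq> B \<Longrightarrow> poly_over A \<subseteq> poly_over B"
  by (auto simp: poly_over_def)

lemma subgroup_plus_poly_over: "subgroup_plus A \<Longrightarrow> subgroup_plus (poly_over A)"
  by (auto simp: subgroup_plus_def poly_over_def)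

lemma poly_over_mult:
  fixes p q :: "'a::comm_ring_1 poly"
  assumes "subgroup_plus C" "\<And>x y. x \<in> A \<Longrightarrow> y \<in> B \<Longrightarrow> x * y \<in> C"
    "p \<in> poly_over A" "q \<in> poly_over B"
  shows "p * q \<in> poly_over C"
  using assms(3,4) unfolding poly_over_def
  by (auto simp: coeff_mult intro!: subgroup_plus_sum assms(1,2))

text \<open>
  Dividing by a monic polynomial over \<open>R\<close> never needs the inverse of a leading coefficient, so the
  usual division algorithm stays inside any \<open>R\<close>-submodule \<open>A\<close> of the field.
\<close>

lemma poly_over_divmod_monic:
  fixes \<phi> p :: "'a::field poly"
  assumes A: "subgroup_plus A" and RA: "\<And>x r. x \<in> A \<Longrightarrow> r \<in> R \<Longrightarrow> x * r \<in> A"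
    and \<phi>: "\<phi> \<in> poly_over R" "lead_coeff \<phi> = 1"
    and p: "p \<in> poly_over A"
  shows "p div \<phi> \<in> poly_over A \<and> p mod \<phi> \<in> poly_over A"
  using p
proof (induction "Polynomial.degree p" arbitrary: p rule: less_induct)
  case less
  note SA = subgroup_plus_poly_over[OF A]
  show ?case
  proof (cases "Polynomial.degree p < Polynomial.degree \<phi>")
    case True
    then show ?thesis
      using less.prems subgroup_plus_zero[OF SA] by (simp add: div_poly_less mod_poly_less)
  next
    case False
    (* one step of long division: subtract the multiple of \<phi> that cancels the leading term of p *)
    define n where "n = Polynomial.degree p - Polynomial.degree \<phi>"
    define t where "t = Polynomial.monom (lead_coeff p) n"
    define q where "q = p - t * \<phi>"
    have \<phi>0: "\<phi> \<noteq> 0"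
      using \<phi>(2) by auto
    have t: "t \<in> poly_over A"
      using less.prems A by (auto simp: t_def poly_over_def subgroup_plus_zero)
    have q: "q \<in> poly_over A"
      unfolding q_def using less.prems by (intro subgroup_plus_diff[OF SA] poly_over_mult[OF A RA t \<phi>(1)])
    have p: "p = q + t * \<phi>"
      by (simp add: q_def)
    have dm: "p div \<phi> = q div \<phi> + t" "p mod \<phi> = q mod \<phi>"
      unfolding p using \<phi>0 by simp_all
    have IH: "q div \<phi> \<in> poly_over A \<and> q mod \<phi> \<in> poly_over A"
    proof (cases "Polynomial.degree p = 0")
      case True
      then have "Polynomial.degree \<phi> = 0" using False by simp
      then have "\<phi> = 1"
        using \<phi>(2) by (auto elim!: degree_eq_zeroE simp: one_pCons)
      moreover from True obtain c where "p = [:c:]" by (rule degree_eq_zeroE)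
      ultimately have "q = 0"
        by (simp add: q_def t_def n_def monom_0)
      then show ?thesis
        using subgroup_plus_zero[OF SA] by simp
    next
      case nz: False
      have "Polynomial.degree (t * \<phi>) \<le> Polynomial.degree p"
        using degree_mult_le[of t \<phi>] degree_monom_le[of "lead_coeff p" n] False
        unfolding t_def n_def by linarith
      moreover have "poly.coeff (t * \<phi>) (Polynomial.degree p) = lead_coeff p"
        using \<phi>(2) False by (simp add: t_def n_def coeff_monom_mult)
      ultimately have "Polynomial.degree q < Polynomial.degree p"
        using nz unfolding q_def
        by (intro degree_lessI) (auto simp: coeff_eq_0 le_less)
      then show ?thesis
        using less.hyps q by blast
    qed
    then show ?thesis
      unfolding dm using t by (auto intro: subgroup_plus_add[OF SA])
  qed
qed

text \<open>
  The closed and the open ball of radius \<open>c\<close> around \<open>0\<close>. The radii lie in the divisible closure,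
  since the weights \<open>\<gamma> - i \<mu>\<close> used later need not be values. Letting \<open>0\<close> belong to every ball
  expresses that its value is infinite.
\<close>

definition val_cball :: "('k::field \<Rightarrow> 'g::linordered_ab_group_add) \<Rightarrow> 'g divcl \<Rightarrow> 'k set" where
  "val_cball v c = {x. x \<noteq> 0 \<longrightarrow> c \<le> divcl_embed (v x)}"

definition val_oball :: "('k::field \<Rightarrow> 'g::linordered_ab_group_add) \<Rightarrow> 'g divcl \<Rightarrow> 'k set" where
  "val_oball v c = {x. x \<noteq> 0 \<longrightarrow> c < divcl_embed (v x)}"

lemma val_oball_subset_cball: "val_oball v c \<subseteq> val_cball v c"
  by (auto simp: val_oball_def val_cball_def)

lemma val_cball_subset_oball: "c < d \<Longrightarrow> val_cball v d \<subseteq> val_oball v c"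
  by (auto simp: val_oball_def val_cball_def)

lemma integral_poly_iff: "integral_poly v p \<longleftrightarrow> p \<in> poly_over (val_cball v 0)"
proof -
  have "divcl_embed 0 \<le> divcl_embed (v x) \<longleftrightarrow> 0 \<le> v x" for x
    by (rule divcl_embed_le_iff)
  then show ?thesis
    by (auto simp: integral_poly_def valuation_ring_def poly_over_def val_cball_def)
qed

lemma valuation_ideal_eq: "valuation_ideal v = val_oball v 0"
  using divcl_embed_less_iff[of 0] by (auto simp: valuation_ideal_def val_oball_def)

lemma carrier_valuation_ring: "carrier (valuation_ring v) = val_cball v 0"
  using divcl_embed_le_iff[of 0] by (auto simp: valuation_ring_def val_cball_def)

context krull_valuation
begin

lemma v_one [simp]: "v 1 = 0"
  using v_mult[of 1 1] by simp

lemma v_minus_one [simp]: "v (- 1) = 0"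
  using v_mult[of "- 1" "- 1"] by simp

lemma v_uminus: "x \<noteq> 0 \<Longrightarrow> v (- x) = v x"
  using v_mult[of "- 1" x] by simp

lemma v_inverse: "x \<noteq> 0 \<Longrightarrow> v (inverse x) = - v x"
  using v_mult[of x "inverse x"] by (simp add: eq_neg_iff_add_eq_0 add.commute)

lemma min_v_le_diff:
  assumes "x \<noteq> 0" "y \<noteq> 0" "x - y \<noteq> 0"
  shows "v x \<le> v (x - y) \<or> v y \<le> v (x - y)"
  using v_add[of x "- y"] assms v_uminus[of y] by (auto simp: min_le_iff_disj)

lemma subgroup_plus_val_cball: "subgroup_plus (val_cball v c)"
  unfolding subgroup_plus_def
proof (intro conjI ballI)
  fix x y assume xy: "x \<in> val_cball v c" "y \<in> val_cball v c"
  show "x - y \<in> val_cball v c"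
  proof (cases "x = 0 \<or> y = 0 \<or> x - y = 0")
    case True
    then show ?thesis using xy v_uminus[of y] by (auto simp: val_cball_def)
  next
    case False
    then have "c \<le> divcl_embed (v x)" "c \<le> divcl_embed (v y)"
      using xy by (auto simp: val_cball_def)
    moreover have "divcl_embed (v x) \<le> divcl_embed (v (x - y)) \<or>
        divcl_embed (v y) \<le> divcl_embed (v (x - y))"
      unfolding divcl_embed_le_iff using False by (intro min_v_le_diff) auto
    ultimately have "c \<le> divcl_embed (v (x - y))"
      by (meson order_trans)
    then show ?thesis by (simp add: val_cball_def)
  qed
qed (simp add: val_cball_def)

lemma subgroup_plus_val_oball: "subgroup_plus (val_oball v c)"
  unfolding subgroup_plus_def
proof (intro conjI ballI)
  fix x y assume xy: "x \<in> val_oball v c" "y \<in> val_oball v c"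
  show "x - y \<in> val_oball v c"
  proof (cases "x = 0 \<or> y = 0 \<or> x - y = 0")
    case True
    then show ?thesis using xy v_uminus[of y] by (auto simp: val_oball_def)
  next
    case False
    then have "c < divcl_embed (v x)" "c < divcl_embed (v y)"
      using xy by (auto simp: val_oball_def)
    moreover have "divcl_embed (v x) \<le> divcl_embed (v (x - y)) \<or>
        divcl_embed (v y) \<le> divcl_embed (v (x - y))"
      unfolding divcl_embed_le_iff using False by (intro min_v_le_diff) auto
    ultimately have "c < divcl_embed (v (x - y))"
      by (meson less_le_trans)
    then show ?thesis by (simp add: val_oball_def)
  qed
qed (simp add: val_oball_def)

lemma divcl_embed_v_mult:
  "x \<noteq> 0 \<Longrightarrow> y \<noteq> 0 \<Longrightarrow> divcl_embed (v (x * y)) = divcl_embed (v x) + divcl_embed (v y)"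
  by (simp add: v_mult divcl_embed_add)

lemma val_cball_mult:
  "x \<in> val_cball v c \<Longrightarrow> y \<in> val_cball v d \<Longrightarrow> x * y \<in> val_cball v (c + d)"
  by (auto simp: val_cball_def divcl_embed_v_mult intro: add_mono)

lemma val_oball_mult:
  "x \<in> val_oball v c \<Longrightarrow> y \<in> val_cball v d \<Longrightarrow> x * y \<in> val_oball v (c + d)"
  by (auto simp: val_cball_def val_oball_def divcl_embed_v_mult intro: add_less_le_mono)

lemma smult_val_cball_iff:
  "x \<noteq> 0 \<Longrightarrow> Polynomial.smult x p \<in> poly_over (val_cball v c) \<longleftrightarrow>
     p \<in> poly_over (val_cball v (c - divcl_embed (v x)))"
  by (auto simp: poly_over_def val_cball_def divcl_embed_v_mult algebra_simps)

lemma smult_val_oball_iff: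
  "x \<noteq> 0 \<Longrightarrow> Polynomial.smult x p \<in> poly_over (val_oball v c) \<longleftrightarrow>
     p \<in> poly_over (val_oball v (c - divcl_embed (v x)))"
  by (auto simp: poly_over_def val_oball_def divcl_embed_v_mult algebra_simps)

lemma poly_cball_mult:
  "p \<in> poly_over (val_cball v c) \<Longrightarrow> q \<in> poly_over (val_cball v d) \<Longrightarrow>
     p * q \<in> poly_over (val_cball v (c + d))"
  by (rule poly_over_mult[OF subgroup_plus_val_cball val_cball_mult])

lemma poly_oball_mult:
  "p \<in> poly_over (val_oball v c) \<Longrightarrow> q \<in> poly_over (val_cball v d) \<Longrightarrow>
     p * q \<in> poly_over (val_oball v (c + d))"
  by (rule poly_over_mult[OF subgroup_plus_val_oball val_oball_mult])

lemma poly_cball_divmod: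
  assumes "integral_poly v \<phi>" "lead_coeff \<phi> = 1" "p \<in> poly_over (val_cball v c)"
  shows "p div \<phi> \<in> poly_over (val_cball v c)" "p mod \<phi> \<in> poly_over (val_cball v c)"
  using poly_over_divmod_monic[OF subgroup_plus_val_cball _ _ assms(2,3), of "val_cball v 0"]
    val_cball_mult[of _ c _ 0] assms(1) by (auto simp: integral_poly_iff)

lemma poly_oball_divmod:
  assumes "integral_poly v \<phi>" "lead_coeff \<phi> = 1" "p \<in> poly_over (val_oball v c)"
  shows "p div \<phi> \<in> poly_over (val_oball v c)" "p mod \<phi> \<in> poly_over (val_oball v c)"
  using poly_over_divmod_monic[OF subgroup_plus_val_oball _ _ assms(2,3), of "val_cball v 0"]
    val_oball_mult[of _ c _ 0] assms(1) by (auto simp: integral_poly_iff)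

lemma exact_poly_value:
  assumes "p \<in> poly_over (val_cball v c)" "p \<notin> poly_over (val_oball v c)"
  obtains x where "x \<noteq> 0" "c = divcl_embed (v x)"
proof -
  obtain i where i: "poly.coeff p i \<notin> val_oball v c"
    using assms(2) by (auto simp: poly_over_def)
  moreover have "poly.coeff p i \<in> val_cball v c"
    using assms(1) by (auto simp: poly_over_def)
  ultimately show ?thesis
    by (intro that[of "poly.coeff p i"]) (auto simp: val_oball_def val_cball_def)
qed

end

section \<open>Reduction modulo the valuation ideal\<close>

context krull_valuation
begin

lemma cring_valuation_ring: "cring (valuation_ring v)"
proof (rule cringI)
  note S = subgroup_plus_val_cball[of 0]
  let ?R = "valuation_ring v"
  have c: "carrier ?R = val_cball v 0" by (rule carrier_valuation_ring)
  have ops: "mult ?R = (*)" "one ?R = 1" "zero ?R = 0" "add ?R = (+)"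
    by (simp_all add: valuation_ring_def)
  show "abelian_group ?R"
  proof (rule abelian_groupI)
    fix x assume "x \<in> carrier ?R"
    then show "\<exists>y\<in>carrier ?R. y \<oplus>\<^bsub>?R\<^esub> x = \<zero>\<^bsub>?R\<^esub>"
      unfolding c ops using subgroup_plus_diff[OF S subgroup_plus_zero[OF S], of x]
      by (intro bexI[of _ "- x"]) auto
  qed (auto simp: c ops intro: subgroup_plus_add[OF S] subgroup_plus_zero[OF S])
  show "comm_monoid ?R"
    by (rule comm_monoidI) (use val_cball_mult[of _ 0 _ 0] in \<open>auto simp: c ops val_cball_def\<close>)
  show "\<And>x y z. x \<in> carrier ?R \<Longrightarrow> y \<in> carrier ?R \<Longrightarrow> z \<in> carrier ?R \<Longrightarrow>
       (x \<oplus>\<^bsub>?R\<^esub> y) \<otimes>\<^bsub>?R\<^esub> z = x \<otimes>\<^bsub>?R\<^esub> z \<oplus>\<^bsub>?R\<^esub> y \<otimes>\<^bsub>?R\<^esub> z"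
    by (simp add: ops algebra_simps)
qed

lemma ideal_valuation_ideal: "ideal (valuation_ideal v) (valuation_ring v)"
proof (rule idealI)
  interpret cring "valuation_ring v" by (rule cring_valuation_ring)
  show "ring (valuation_ring v)" by (rule ring_axioms)
  let ?R = "valuation_ring v"
  have ops: "mult ?R = (*)" "one ?R = 1" "zero ?R = 0" "add ?R = (+)"
    by (simp_all add: valuation_ring_def)
  note S = subgroup_plus_val_oball[of 0]
  show "subgroup (valuation_ideal v) (add_monoid ?R)"
  proof (rule add.subgroupI)
    show "valuation_ideal v \<subseteq> carrier ?R"
      unfolding valuation_ideal_eq carrier_valuation_ring by (rule val_oball_subset_cball)
    show "valuation_ideal v \<noteq> {}"
      using subgroup_plus_zero[OF S] by (auto simp: valuation_ideal_eq)
    fix x y assume x: "x \<in> valuation_ideal v" and y: "y \<in> valuation_ideal v"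
    show "x \<oplus>\<^bsub>?R\<^esub> y \<in> valuation_ideal v"
      using x y by (auto simp: valuation_ideal_eq ops intro: subgroup_plus_add[OF S])
    have xm: "- x \<in> val_oball v 0" using subgroup_plus_diff[OF S subgroup_plus_zero[OF S], of x] x
      by (simp add: valuation_ideal_eq)
    have "\<ominus>\<^bsub>?R\<^esub> x = - x"
      using xm x val_oball_subset_cball
      by (intro minus_equality) (auto simp: ops carrier_valuation_ring valuation_ideal_eq)
    then show "\<ominus>\<^bsub>?R\<^esub> x \<in> valuation_ideal v"
      using xm by (simp add: valuation_ideal_eq)
  qed
  fix a x assume "a \<in> valuation_ideal v" "x \<in> carrier ?R"
  then show "x \<otimes>\<^bsub>?R\<^esub> a \<in> valuation_ideal v" "a \<otimes>\<^bsub>?R\<^esub> x \<in> valuation_ideal v"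
    using val_oball_mult[of a 0 x 0]
    by (simp_all add: ops valuation_ideal_eq carrier_valuation_ring mult.commute)
qed

lemma maximalideal_valuation_ideal: "maximalideal (valuation_ideal v) (valuation_ring v)"
proof (rule maximalidealI)
  interpret cring "valuation_ring v" by (rule cring_valuation_ring)
  let ?R = "valuation_ring v"
  have ops: "mult ?R = (*)" "one ?R = 1" "zero ?R = 0" "add ?R = (+)"
    by (simp_all add: valuation_ring_def)
  show "ideal (valuation_ideal v) ?R" by (rule ideal_valuation_ideal)
  have "1 \<in> carrier ?R" "1 \<notin> valuation_ideal v"
    by (simp_all add: valuation_ring_def valuation_ideal_def)
  then show "carrier ?R \<noteq> valuation_ideal v" by blast
  fix J assume J: "ideal J ?R" "valuation_ideal v \<subseteq> J" "J \<subseteq> carrier ?R"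
  show "J = valuation_ideal v \<or> J = carrier ?R"
  proof (cases "J = valuation_ideal v")
    case False
    then obtain x where x: "x \<in> J" "x \<notin> valuation_ideal v" using J by blast
    then have "x \<noteq> 0" "v x = 0"
      using J(3) by (auto simp: valuation_ideal_def valuation_ring_def)
    moreover from this have "inverse x \<in> carrier ?R"
      by (simp add: valuation_ring_def v_inverse)
    ultimately have "\<one>\<^bsub>?R\<^esub> \<in> J"
      using ideal.I_l_closed[OF J(1) x(1), of "inverse x"] by (simp add: ops)
    then show ?thesis
      using ideal.one_imp_carrier[OF J(1)] by simp
  qed simp
qed

lemma field_residue_field: "Ring.field (residue_field v)"
  unfolding residue_field_def
  by (rule maximalideal.quotient_is_field[OF maximalideal_valuation_ideal cring_valuation_ring])

lemma ring_hom_cring_residue: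
  "ring_hom_cring (valuation_ring v) (residue_field v) ((+>\<^bsub>valuation_ring v\<^esub>) (valuation_ideal v))"
  unfolding residue_field_def
  by (rule ideal.rcos_ring_hom_cring[OF ideal_valuation_ideal cring_valuation_ring])

lemma residue_eq_zero_iff:
  assumes "x \<in> carrier (valuation_ring v)"
  shows "valuation_ideal v +>\<^bsub>valuation_ring v\<^esub> x = \<zero>\<^bsub>residue_field v\<^esub> \<longleftrightarrow> x \<in> valuation_ideal v"
proof -
  interpret cring "valuation_ring v" by (rule cring_valuation_ring)
  interpret ideal "valuation_ideal v" "valuation_ring v" by (rule ideal_valuation_ideal)
  have z: "\<zero>\<^bsub>residue_field v\<^esub> = valuation_ideal v"
    by (simp add: residue_field_def FactRing_def)
  show ?thesis
    unfolding z using assms a_rcos_self a_rcos_const by (auto simp: a_r_coset_def)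
qed

lemma reduce_poly_nth_eq_zero_iff:
  assumes "integral_poly v p"
  shows "reduce_poly v p i = \<zero>\<^bsub>residue_field v\<^esub> \<longleftrightarrow> poly.coeff p i \<in> val_oball v 0"
  using residue_eq_zero_iff assms
  by (simp add: reduce_poly_def integral_poly_def valuation_ideal_eq)

lemma reduce_poly_carrier:
  assumes "integral_poly v p"
  shows "reduce_poly v p \<in> carrier (UP (residue_field v))"
proof -
  interpret ring_hom_cring "valuation_ring v" "residue_field v"
    "(+>\<^bsub>valuation_ring v\<^esub>) (valuation_ideal v)" by (rule ring_hom_cring_residue)
  have "reduce_poly v p \<in> up (residue_field v)"
  proof (rule mem_upI)
    show "reduce_poly v p n \<in> carrier (residue_field v)" for n
      unfolding reduce_poly_def using assms by (intro hom_closed) (simp add: integral_poly_def)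
    have "bound \<zero>\<^bsub>residue_field v\<^esub> (Polynomial.degree p) (reduce_poly v p)"
      by (rule bound.intro)
        (simp add: reduce_poly_nth_eq_zero_iff[OF assms] coeff_eq_0 val_oball_def)
    then show "\<exists>n. bound \<zero>\<^bsub>residue_field v\<^esub> n (reduce_poly v p)" by blast
  qed
  then show ?thesis by (simp add: UP_def)
qed

lemma integral_poly_mult: "integral_poly v p \<Longrightarrow> integral_poly v q \<Longrightarrow> integral_poly v (p * q)"
  unfolding integral_poly_iff using poly_cball_mult[of p 0 q 0] by simp

lemma reduce_poly_add:
  assumes "integral_poly v p" "integral_poly v q"
  shows "reduce_poly v (p + q) = reduce_poly v p \<oplus>\<^bsub>UP (residue_field v)\<^esub> reduce_poly v q"
proof -
  interpret ring_hom_cring "valuation_ring v" "residue_field v"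
    "(+>\<^bsub>valuation_ring v\<^esub>) (valuation_ideal v)" by (rule ring_hom_cring_residue)
  have "add (valuation_ring v) = (+)" by (simp add: valuation_ring_def)
  then have "reduce_poly v (p + q) n = reduce_poly v p n \<oplus>\<^bsub>residue_field v\<^esub> reduce_poly v q n" for n
    using hom_add[of "poly.coeff p n" "poly.coeff q n"] assms
    by (simp add: reduce_poly_def integral_poly_def)
  then show ?thesis
    using assms[THEN reduce_poly_carrier] by (simp add: UP_def fun_eq_iff)
qed

lemma finsum_valuation_ring:
  assumes "finite I" "\<And>i. i \<in> I \<Longrightarrow> f i \<in> carrier (valuation_ring v)"
  shows "finsum (valuation_ring v) f I = sum f I"
proof -
  interpret cring "valuation_ring v" by (rule cring_valuation_ring)
  show ?thesis
    using assms
  proof (induction I rule: finite_induct)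
    case empty
    then show ?case by simp (simp add: valuation_ring_def)
  next
    case (insert x F)
    then have "finsum (valuation_ring v) f (insert x F) = f x \<oplus>\<^bsub>valuation_ring v\<^esub> sum f F"
      by (subst finsum_insert) auto
    then show ?case using insert by (simp add: valuation_ring_def)
  qed
qed

lemma reduce_poly_mult:
  assumes "integral_poly v p" "integral_poly v q"
  shows "reduce_poly v (p * q) = reduce_poly v p \<otimes>\<^bsub>UP (residue_field v)\<^esub> reduce_poly v q"
proof -
  interpret ring_hom_cring "valuation_ring v" "residue_field v"
    "(+>\<^bsub>valuation_ring v\<^esub>) (valuation_ideal v)" by (rule ring_hom_cring_residue)
  let ?R = "valuation_ring v"
  have mult: "x * y = x \<otimes>\<^bsub>?R\<^esub> y" for x y by (simp add: valuation_ring_def)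
  have c: "poly.coeff p i \<in> carrier ?R" "poly.coeff q i \<in> carrier ?R" for i
    using assms by (simp_all add: integral_poly_def)
  have "reduce_poly v (p * q) n =
      (\<Oplus>\<^bsub>residue_field v\<^esub>i\<in>{..n}. reduce_poly v p i \<otimes>\<^bsub>residue_field v\<^esub> reduce_poly v q (n - i))" for n
  proof -
    have "poly.coeff (p * q) n = (\<Oplus>\<^bsub>?R\<^esub>i\<in>{..n}. poly.coeff p i \<otimes>\<^bsub>?R\<^esub> poly.coeff q (n - i))"
      unfolding coeff_mult mult using c by (intro finsum_valuation_ring[symmetric]) auto
    then show ?thesis
      unfolding reduce_poly_def using c
      by (simp add: hom_finsum Pi_def o_def)
  qed
  then show ?thesis
    using assms[THEN reduce_poly_carrier] by (simp add: UP_def fun_eq_iff)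
qed

end

text \<open>
  The library's pseudo-division multiplies the dividend by a power of the leading coefficient of the
  divisor; over a field this power can be divided out. The purpose is to conclude that irreducible
  elements of \<open>UP F\<close> are prime.
\<close>

lemma UP_field_euclidean_domain:
  assumes "Ring.field F"
  shows "euclidean_domain (UP F) (deg F)"
proof -
  interpret F: Ring.field F by (rule assms)
  interpret UP_domain F "UP F" by unfold_locales simp_all
  show ?thesis
  proof (rule domain.euclidean_domainI)
    show "domain (UP F)" by (rule UP_domain)
    fix f g assume "f \<in> carrier (UP F) - {\<zero>\<^bsub>UP F\<^esub>}" and "g \<in> carrier (UP F) - {\<zero>\<^bsub>UP F\<^esub>}"
    then have f: "f \<in> carrier (UP F)" and g: "g \<in> carrier (UP F)" and g0: "g \<noteq> \<zero>\<^bsub>UP F\<^esub>"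
      by auto
    define c where "c = up_ring.coeff (UP F) g (deg F g)"
    obtain q r k where q: "q \<in> carrier (UP F)" and r: "r \<in> carrier (UP F)"
      and eq: "c [^]\<^bsub>F\<^esub> (k::nat) \<odot>\<^bsub>UP F\<^esub> f = g \<otimes>\<^bsub>UP F\<^esub> q \<oplus>\<^bsub>UP F\<^esub> r"
      and dr: "r = \<zero>\<^bsub>UP F\<^esub> \<or> deg F r < deg F g"
      using long_div_theorem[OF g f g0] unfolding c_def by blast
    have "c \<in> carrier F" "c \<noteq> \<zero>\<^bsub>F\<^esub>"
      using g g0 lcoeff_nonzero2 unfolding c_def by auto
    then have "c [^]\<^bsub>F\<^esub> k \<in> Units F"
      by (intro F.Units_pow_closed) (simp add: F.field_Units)
    then obtain u where u: "u \<in> carrier F" "u \<otimes>\<^bsub>F\<^esub> c [^]\<^bsub>F\<^esub> k = \<one>\<^bsub>F\<^esub>" "c [^]\<^bsub>F\<^esub> k \<in> carrier F"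
      by (meson F.Units_closed F.Units_inv_closed F.Units_l_inv)
    have "f = u \<odot>\<^bsub>UP F\<^esub> (c [^]\<^bsub>F\<^esub> k \<odot>\<^bsub>UP F\<^esub> f)"
      using u f smult_assoc1[OF u(1,3) f] by simp
    also have "\<dots> = g \<otimes>\<^bsub>UP F\<^esub> (u \<odot>\<^bsub>UP F\<^esub> q) \<oplus>\<^bsub>UP F\<^esub> u \<odot>\<^bsub>UP F\<^esub> r"
      unfolding eq using u g q r UP_smult_assoc2[OF u(1) q g]
        UP_m_comm[OF g q] UP_m_comm[OF g smult_closed[OF u(1) q]]
      by (simp add: smult_r_distr)
    finally have *: "f = g \<otimes>\<^bsub>UP F\<^esub> (u \<odot>\<^bsub>UP F\<^esub> q) \<oplus>\<^bsub>UP F\<^esub> u \<odot>\<^bsub>UP F\<^esub> r" .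
    have "u \<odot>\<^bsub>UP F\<^esub> r = \<zero>\<^bsub>UP F\<^esub> \<or> deg F (u \<odot>\<^bsub>UP F\<^esub> r) < deg F g"
      using dr deg_smult_decr[OF u(1) r] u(1) by auto
    then show "\<exists>q r. q \<in> carrier (UP F) \<and> r \<in> carrier (UP F) \<and>
        f = g \<otimes>\<^bsub>UP F\<^esub> q \<oplus>\<^bsub>UP F\<^esub> r \<and> (r = \<zero>\<^bsub>UP F\<^esub> \<or> deg F r < deg F g)"
      using * smult_closed[OF u(1) q] smult_closed[OF u(1) r] by blast
  qed
qed

context krull_valuation
begin

lemma deg_reduce_poly_le:
  assumes "integral_poly v p"
  shows "deg (residue_field v) (reduce_poly v p) \<le> Polynomial.degree p"
proof -
  interpret F: Ring.field "residue_field v" by (rule field_residue_field)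
  interpret UP_domain "residue_field v" "UP (residue_field v)" by unfold_locales simp_all
  show ?thesis
    using reduce_poly_carrier[OF assms]
    by (intro deg_aboveI)
      (auto simp: UP_def reduce_poly_nth_eq_zero_iff[OF assms] coeff_eq_0 val_oball_def)
qed

lemma deg_reduce_monic_poly:
  assumes "integral_poly v p" "lead_coeff p = 1"
  shows "deg (residue_field v) (reduce_poly v p) = Polynomial.degree p"
proof -
  interpret F: Ring.field "residue_field v" by (rule field_residue_field)
  interpret UP_domain "residue_field v" "UP (residue_field v)" by unfold_locales simp_all
  have "Polynomial.degree p \<le> deg (residue_field v) (reduce_poly v p)"
    using reduce_poly_carrier[OF assms(1)] assms(2)
    by (intro deg_belowI)
      (auto simp: UP_def reduce_poly_nth_eq_zero_iff[OF assms(1)] val_oball_def)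
  then show ?thesis
    using deg_reduce_poly_le[OF assms(1)] by simp
qed

lemma reduce_poly_eq_zero_iff:
  assumes "integral_poly v p"
  shows "reduce_poly v p = \<zero>\<^bsub>UP (residue_field v)\<^esub> \<longleftrightarrow> p \<in> poly_over (val_oball v 0)"
  using reduce_poly_nth_eq_zero_iff[OF assms] by (auto simp: UP_def poly_over_def fun_eq_iff)

end

text \<open>
  In the language of MacLane, \<open>\<phi>\<close> is a key polynomial over the Gaussian valuation, and the weights
  below define the augmented valuations that belong to it.
\<close>

locale key_poly = krull_valuation v
  for v :: "'k::field \<Rightarrow> 'g::linordered_ab_group_add" +
  fixes \<phi> :: "'k poly"
  assumes integral_phi: "integral_poly v \<phi>"
    and monic_phi: "lead_coeff \<phi> = 1"
    and irreducible_phi: "ring_irreducible\<^bsub>UP (residue_field v)\<^esub> (reduce_poly v \<phi>)"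
begin

lemma degree_phi_pos: "0 < Polynomial.degree \<phi>"
proof (rule ccontr)
  assume "\<not> ?thesis"
  then have deg0: "Polynomial.degree \<phi> = 0" by simp
  interpret F: Ring.field "residue_field v" by (rule field_residue_field)
  interpret UP_domain "residue_field v" "UP (residue_field v)" by unfold_locales simp_all
  have "\<phi> = 1"
    using deg0 monic_phi by (auto elim!: degree_eq_zeroE simp: one_pCons)
  moreover have i1: "integral_poly v 1" using integral_phi \<open>\<phi> = 1\<close> by simp
  ultimately have "reduce_poly v \<phi> \<otimes>\<^bsub>UP (residue_field v)\<^esub> reduce_poly v \<phi> = reduce_poly v \<phi>"
    using reduce_poly_mult[of 1 1] by simp
  moreover have c: "reduce_poly v \<phi> \<in> carrier (UP (residue_field v))"
    by (rule reduce_poly_carrier[OF integral_phi])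
  moreover have "reduce_poly v \<phi> \<noteq> \<zero>\<^bsub>UP (residue_field v)\<^esub>"
    using irreducible_phi by (simp add: ring_irreducible_def)
  ultimately have "reduce_poly v \<phi> = \<one>\<^bsub>UP (residue_field v)\<^esub>"
    using domain.m_lcancel[OF UP_domain, of "reduce_poly v \<phi>" "reduce_poly v \<phi>" "\<one>\<^bsub>UP (residue_field v)\<^esub>"]
    by simp
  then show False
    using domain.ring_irreducibleE(4)[OF UP_domain c irreducible_phi] by simp
qed

text \<open>
  If the remainder vanished modulo the valuation ideal, the reduction of \<open>\<phi>\<close> would divide the
  product of the reductions of \<open>a\<close> and \<open>b\<close>, hence one of them. This is impossible for degree
  reasons.
\<close>

lemma integral_mult_mod_phi:
  assumes a: "integral_poly v a" "Polynomial.degree a < Polynomial.degree \<phi>" "a \<notin> poly_over (val_oball v 0)"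
    and b: "integral_poly v b" "Polynomial.degree b < Polynomial.degree \<phi>" "b \<notin> poly_over (val_oball v 0)"
  shows "a * b mod \<phi> \<notin> poly_over (val_oball v 0)"
proof
  let ?F = "residue_field v"
  let ?r = "reduce_poly v"
  assume c0: "a * b mod \<phi> \<in> poly_over (val_oball v 0)"
  interpret F: Ring.field ?F by (rule field_residue_field)
  interpret UP_domain ?F "UP ?F" by unfold_locales simp_all
  interpret E: euclidean_domain "UP ?F" "deg ?F"
    by (rule UP_field_euclidean_domain[OF field_residue_field])
  have ab: "integral_poly v (a * b)" using a b by (intro integral_poly_mult)
  then have d: "integral_poly v (a * b div \<phi>)" and c: "integral_poly v (a * b mod \<phi>)"
    using poly_cball_divmod[OF integral_phi monic_phi] by (simp_all add: integral_poly_iff)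
  have "?r a \<otimes>\<^bsub>UP ?F\<^esub> ?r b = ?r (\<phi> * (a * b div \<phi>) + a * b mod \<phi>)"
    using reduce_poly_mult[OF a(1) b(1)] by simp
  also have "\<dots> = ?r \<phi> \<otimes>\<^bsub>UP ?F\<^esub> ?r (a * b div \<phi>) \<oplus>\<^bsub>UP ?F\<^esub> \<zero>\<^bsub>UP ?F\<^esub>"
    using integral_phi c d unfolding reduce_poly_eq_zero_iff[OF c, THEN iffD2, OF c0, symmetric]
    by (simp only: reduce_poly_add reduce_poly_mult integral_poly_mult)
  finally have "?r \<phi> divides\<^bsub>UP ?F\<^esub> ?r a \<otimes>\<^bsub>UP ?F\<^esub> ?r b"
    using reduce_poly_carrier integral_phi d by (intro dividesI[of "?r (a * b div \<phi>)"]) auto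
  moreover have "ring_prime\<^bsub>UP ?F\<^esub> (?r \<phi>)"
    using E.primeness_condition reduce_poly_carrier[OF integral_phi] irreducible_phi by blast
  then have "Divisibility.prime (UP ?F) (?r \<phi>)"
    by (rule domain.ring_primeE(3)[OF UP_domain reduce_poly_carrier[OF integral_phi]])
  ultimately have "?r \<phi> divides\<^bsub>UP ?F\<^esub> ?r a \<or> ?r \<phi> divides\<^bsub>UP ?F\<^esub> ?r b"
    using reduce_poly_carrier[OF a(1)] reduce_poly_carrier[OF b(1)] by (auto elim: primeE)
  moreover have "\<not> ?r \<phi> divides\<^bsub>UP ?F\<^esub> ?r p"
    if p: "integral_poly v p" "Polynomial.degree p < Polynomial.degree \<phi>" "p \<notin> poly_over (val_oball v 0)" for p
  proof
    assume "?r \<phi> divides\<^bsub>UP ?F\<^esub> ?r p"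
    then obtain q where q: "q \<in> carrier (UP ?F)" "?r p = ?r \<phi> \<otimes>\<^bsub>UP ?F\<^esub> q"
      by (auto simp: factor_def)
    have "?r p \<noteq> \<zero>\<^bsub>UP ?F\<^esub>" using reduce_poly_eq_zero_iff[OF p(1)] p(3) by simp
    then have "?r \<phi> \<noteq> \<zero>\<^bsub>UP ?F\<^esub>" "q \<noteq> \<zero>\<^bsub>UP ?F\<^esub>"
      using q reduce_poly_carrier[OF integral_phi] by auto
    then have "deg ?F (?r p) = deg ?F (?r \<phi>) + deg ?F q"
      unfolding q(2) using q(1) reduce_poly_carrier[OF integral_phi] by (intro deg_mult) auto
    then show False
      using deg_reduce_poly_le[OF p(1)] deg_reduce_monic_poly[OF integral_phi monic_phi] p(2) by simp
  qed
  ultimately show False using a b by blast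
qed

text \<open>
  The remainder has no larger value than the product itself. Each of the values \<open>\<alpha>\<close>, \<open>\<beta>\<close> is
  attained by a coefficient, and dividing \<open>a\<close> and \<open>b\<close> by these coefficients reduces the claim to the
  integral case.
\<close>

lemma mult_mod_phi_exact:
  assumes a: "a \<in> poly_over (val_cball v \<alpha>)" "a \<notin> poly_over (val_oball v \<alpha>)" "Polynomial.degree a < Polynomial.degree \<phi>"
    and b: "b \<in> poly_over (val_cball v \<beta>)" "b \<notin> poly_over (val_oball v \<beta>)" "Polynomial.degree b < Polynomial.degree \<phi>"
  shows "a * b mod \<phi> \<notin> poly_over (val_oball v (\<alpha> + \<beta>))"
proof -
  obtain x where x: "x \<noteq> 0" "\<alpha> = divcl_embed (v x)" using exact_poly_value a by blast
  obtain y where y: "y \<noteq> 0" "\<beta> = divcl_embed (v y)" using exact_poly_value b by blast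
  have "Polynomial.smult (inverse x) a * Polynomial.smult (inverse y) b mod \<phi> \<notin> poly_over (val_oball v 0)"
    using x y a b
    by (intro integral_mult_mod_phi)
      (simp_all add: integral_poly_iff smult_val_cball_iff smult_val_oball_iff v_inverse divcl_embed_uminus)
  then have "Polynomial.smult (inverse (x * y)) (a * b mod \<phi>) \<notin> poly_over (val_oball v 0)"
    by (simp add: mod_smult_left mult.commute)
  moreover have "divcl_embed (v (inverse (x * y))) = - (\<alpha> + \<beta>)"
    using x y v_inverse[of "x * y"] by (simp add: divcl_embed_uminus divcl_embed_v_mult)
  ultimately show ?thesis
    using x y by (simp add: smult_val_oball_iff add.commute del: inverse_mult_distrib)
qed

end

section \<open>Coefficients of the \<open>\<phi>\<close>-expansion\<close>

lemma is_phi_expansion_phi_coeff: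
  assumes "0 < Polynomial.degree \<phi>"
  shows "is_phi_expansion \<phi> f (phi_coeff \<phi> f)"
  unfolding phi_coeff_def by (rule theI'[OF phi_expansion_ex1[OF assms]])

text \<open>
  This closed form makes the linearity of the coefficients in \<open>f\<close> evident.
\<close>

lemma phi_coeff_eq_div_mod:
  assumes deg: "0 < Polynomial.degree \<phi>"
  shows "phi_coeff \<phi> f k = f div \<phi> ^ k mod \<phi>"
proof -
  have "is_phi_expansion \<phi> f a \<Longrightarrow> a k = f div \<phi> ^ k mod \<phi>" for a
  proof (induction k arbitrary: f a)
    case 0
    then show ?case using is_phi_expansion_Suc[OF deg, of f a] by simp
  next
    case (Suc k)
    then have "is_phi_expansion \<phi> (f div \<phi>) (\<lambda>i. a (Suc i))"
      using is_phi_expansion_Suc[OF deg, of f a] by blast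
    from Suc.IH[OF this] show ?case
      by (simp add: poly_div_mult_right)
  qed
  then show ?thesis using is_phi_expansion_phi_coeff[OF deg] by blast
qed

lemma phi_coeff_sum:
  assumes deg: "0 < Polynomial.degree \<phi>"
  shows "phi_coeff \<phi> (\<Sum>i\<in>I. F i) k = (\<Sum>i\<in>I. phi_coeff \<phi> (F i) k)"
  by (induction I rule: infinite_finite_induct)
    (auto simp: phi_coeff_eq_div_mod[OF deg] poly_div_add_left poly_mod_add_left)

lemma finite_phi_coeff_support: "0 < Polynomial.degree \<phi> \<Longrightarrow> finite {i. phi_coeff \<phi> f i \<noteq> 0}"
  using is_phi_expansion_phi_coeff[of \<phi> f] by (simp add: is_phi_expansion_def)

lemma phi_expansion_sum:
  "0 < Polynomial.degree \<phi> \<Longrightarrow> (\<Sum>i | phi_coeff \<phi> f i \<noteq> 0. phi_coeff \<phi> f i * \<phi> ^ i) = f"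
  using is_phi_expansion_phi_coeff[of \<phi> f] by (simp add: is_phi_expansion_def)

lemma degree_phi_coeff:
  "0 < Polynomial.degree \<phi> \<Longrightarrow> Polynomial.degree (phi_coeff \<phi> f i) < Polynomial.degree \<phi>"
  using degree_mod_less[of \<phi> "f div \<phi> ^ i"]
  by (cases "\<phi> = 0"; cases "f div \<phi> ^ i mod \<phi> = 0") (auto simp: phi_coeff_eq_div_mod)

lemma degree_ge_phi_coeff_index:
  assumes deg: "0 < Polynomial.degree \<phi>" and "phi_coeff \<phi> f k \<noteq> 0"
  shows "k * Polynomial.degree \<phi> \<le> Polynomial.degree f"
proof -
  have "f div \<phi> ^ k \<noteq> 0"
    using assms by (auto simp: phi_coeff_eq_div_mod[OF deg])
  then show ?thesis
    using deg by (auto simp: div_poly_eq_0_iff degree_power_eq not_less)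
qed

text \<open>
  A product of two coefficients has degree below \<open>2 deg \<phi>\<close>, so it produces a single carry.
\<close>

lemma phi_coeff_mult_power:
  assumes deg: "0 < Polynomial.degree \<phi>"
    and p: "Polynomial.degree p < 2 * Polynomial.degree \<phi>"
  shows "phi_coeff \<phi> (p * \<phi> ^ n) k =
    (if k = n then p mod \<phi> else if k = Suc n then p div \<phi> else 0)"
proof -
  have \<phi>0: "\<phi> \<noteq> 0" using deg by auto
  have div0: "p div \<phi> ^ j = 0" if "2 \<le> j" for j
  proof -
    have "2 * Polynomial.degree \<phi> \<le> j * Polynomial.degree \<phi>" using that by (rule mult_le_mono1)
    with p have "Polynomial.degree p < j * Polynomial.degree \<phi>" by linarith
    then show ?thesis using \<phi>0 by (intro div_poly_less) (simp add: degree_power_eq)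
  qed
  show ?thesis
  proof (cases "k < n")
    case True
    have "\<phi> ^ n = \<phi> ^ k * (\<phi> * \<phi> ^ (n - Suc k))"
      using True by (simp flip: power_Suc power_add)
    then have "p * \<phi> ^ n div \<phi> ^ k = p * (\<phi> * \<phi> ^ (n - Suc k))"
      using \<phi>0 by (simp add: ac_simps)
    then show ?thesis using True by (simp add: phi_coeff_eq_div_mod[OF deg])
  next
    case False
    then have "\<phi> ^ k = \<phi> ^ n * \<phi> ^ (k - n)" by (simp flip: power_add)
    then have *: "p * \<phi> ^ n div \<phi> ^ k = p div \<phi> ^ (k - n)"
      using \<phi>0 by (simp add: poly_div_mult_right)
    consider "k = n" | "k = Suc n" | "2 \<le> k - n" using False by linarith
    then show ?thesis
    proof cases
      case 2
      have "p div \<phi> div \<phi> = 0"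
        using div0[of 2] by (simp add: poly_div_mult_right power2_eq_square)
      then show ?thesis
        using 2 * by (simp add: phi_coeff_eq_div_mod[OF deg] mod_eq_self_iff_div_eq_0)
    qed (use * div0 in \<open>auto simp: phi_coeff_eq_div_mod[OF deg]\<close>)
  qed
qed

section \<open>Terms of minimal weight\<close>

context key_poly
begin

text \<open>
  The minimal value of \<open>v\<^sup>x(a\<^sub>i) + i \<mu>\<close> over the coefficients \<open>a\<^sub>i\<close> of \<open>f\<close> is \<open>\<gamma>\<close>, attained for
  the first time at \<open>s\<close> and for the last time at \<open>S\<close>: the points of minimal weight form the face of
  the Newton polygon in the direction \<open>\<mu>\<close>. With membership in balls, vanishing coefficients need no
  separate treatment.
\<close>

definition face :: "'g divcl \<Rightarrow> 'k poly \<Rightarrow> 'g divcl \<Rightarrow> nat \<Rightarrow> nat \<Rightarrow> bool" where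
  "face \<mu> f \<gamma> s S \<longleftrightarrow>
     (\<forall>i. phi_coeff \<phi> f i \<in> poly_over (val_cball v (\<gamma> - nsmul i \<mu>))) \<and>
     (\<forall>i. i < s \<or> S < i \<longrightarrow> phi_coeff \<phi> f i \<in> poly_over (val_oball v (\<gamma> - nsmul i \<mu>))) \<and>
     phi_coeff \<phi> f s \<notin> poly_over (val_oball v (\<gamma> - nsmul s \<mu>)) \<and>
     phi_coeff \<phi> f S \<notin> poly_over (val_oball v (\<gamma> - nsmul S \<mu>))"

lemma face_le: "face \<mu> f \<gamma> s S \<Longrightarrow> s \<le> S"
  unfolding face_def using not_le by blast

lemma face_unique:
  assumes "face \<mu> f \<gamma> s S" "face \<mu> f \<gamma>' s' S'"
  shows "s = s' \<and> S = S'"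
proof -
  have "\<not> \<gamma> < \<gamma>'" if "face \<mu> f \<gamma> s S" "face \<mu> f \<gamma>' s' S'" for \<gamma> \<gamma>' s S s' S'
  proof
    assume "\<gamma> < \<gamma>'"
    then have "val_cball v (\<gamma>' - nsmul s \<mu>) \<subseteq> val_oball v (\<gamma> - nsmul s \<mu>)"
      by (intro val_cball_subset_oball) simp
    then show False
      using that poly_over_mono unfolding face_def by blast
  qed
  from this[OF assms] this[OF assms(2,1)] have "\<gamma> = \<gamma>'" by simp
  then show ?thesis
    using assms unfolding face_def by (metis linorder_neqE_nat)
qed

lemma phi_coeff_eq_zero_oball: "phi_coeff \<phi> f i = 0 \<Longrightarrow> phi_coeff \<phi> f i \<in> poly_over (val_oball v c)"
  by (simp add: poly_over_def val_oball_def)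

lemma face_between:
  assumes ge: "\<And>i. phi_coeff \<phi> f i \<in> poly_over (val_cball v (\<gamma> - nsmul i \<mu>))"
    and e: "phi_coeff \<phi> f e \<notin> poly_over (val_oball v (\<gamma> - nsmul e \<mu>))"
    and e': "phi_coeff \<phi> f e' \<notin> poly_over (val_oball v (\<gamma> - nsmul e' \<mu>))"
  obtains s S where "face \<mu> f \<gamma> s S" "s \<le> e" "e' \<le> S"
proof -
  define E where "E = {i. phi_coeff \<phi> f i \<notin> poly_over (val_oball v (\<gamma> - nsmul i \<mu>))}"
  have mem_E: "i \<in> E \<longleftrightarrow> phi_coeff \<phi> f i \<notin> poly_over (val_oball v (\<gamma> - nsmul i \<mu>))" for i
    by (simp add: E_def)
  have "E \<subseteq> {i. phi_coeff \<phi> f i \<noteq> 0}"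
    using phi_coeff_eq_zero_oball by (auto simp: E_def)
  then have fin: "finite E"
    using finite_phi_coeff_support[OF degree_phi_pos] finite_subset by blast
  have eE: "e \<in> E" "e' \<in> E" using e e' by (simp_all add: E_def)
  then have "Min E \<in> E" "Max E \<in> E" using fin by (auto intro: Min_in Max_in)
  moreover have "i \<notin> E" if "i < Min E \<or> Max E < i" for i
    using that Min_le[OF fin, of i] Max_ge[OF fin, of i] by auto
  ultimately have "face \<mu> f \<gamma> (Min E) (Max E)"
    using ge unfolding face_def mem_E by blast
  then show ?thesis
    using that[of "Min E" "Max E"] eE fin by simp
qed

text \<open>
  In the double sum for the coefficient of \<open>\<phi>\<^sup>k\<close> in \<open>f g\<close> the carries and all pairs \<open>(i, j)\<close>
  outside \<open>[s, S] \<times> [s', S']\<close> contribute terms of weight above \<open>\<gamma> + \<delta>\<close>. For \<open>k\<close> outside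
  \<open>[s + s', S + S']\<close> nothing else is left, and at either end point of this interval exactly one
  further term remains, whose weight is \<open>\<gamma> + \<delta>\<close>, so that no cancellation can occur.
\<close>

lemma face_mult:
  assumes \<mu>: "0 < \<mu>" and f: "face \<mu> f \<gamma> s S" and g: "face \<mu> g \<delta> s' S'"
  shows "face \<mu> (f * g) (\<gamma> + \<delta>) (s + s') (S + S')"
proof -
  note deg = degree_phi_pos
  define a where "a = phi_coeff \<phi> f"
  define b where "b = phi_coeff \<phi> g"
  define I where "I = {i. a i \<noteq> 0} \<times> {j. b j \<noteq> 0}"
  define T where "T = (\<lambda>k (i, j). phi_coeff \<phi> (a i * b j * \<phi> ^ (i + j)) k)"
  (* a polynomial in C k resp. U k, used as coefficient of \<phi>^k, has weight \<ge> resp. > \<gamma> + \<delta> *)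
  define C where "C = (\<lambda>k. poly_over (val_cball v (\<gamma> + \<delta> - nsmul k \<mu>)))"
  define U where "U = (\<lambda>k. poly_over (val_oball v (\<gamma> + \<delta> - nsmul k \<mu>)))"
  have SC: "subgroup_plus (C k)" and SU: "subgroup_plus (U k)" for k
    unfolding C_def U_def
    by (simp_all add: subgroup_plus_poly_over subgroup_plus_val_cball subgroup_plus_val_oball)
  have UC: "U k \<subseteq> C k" for k
    unfolding C_def U_def by (intro poly_over_mono val_oball_subset_cball)
  have finI: "finite I"
    unfolding I_def a_def b_def using finite_phi_coeff_support[OF deg] by blast
  have expand: "phi_coeff \<phi> (f * g) k = (\<Sum>x\<in>I. T k x)" for k
  proof -
    have "f * g = (\<Sum>i | a i \<noteq> 0. a i * \<phi> ^ i) * (\<Sum>j | b j \<noteq> 0. b j * \<phi> ^ j)"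
      unfolding a_def b_def by (simp add: phi_expansion_sum[OF deg])
    also have "\<dots> = (\<Sum>(i, j)\<in>I. a i * b j * \<phi> ^ (i + j))"
      unfolding I_def sum_product sum.cartesian_product
      by (intro sum.cong) (auto simp: power_add ac_simps)
    finally show ?thesis
      unfolding T_def by (simp add: phi_coeff_sum[OF deg] case_prod_unfold)
  qed
  have da: "Polynomial.degree (a i) < Polynomial.degree \<phi>"
    and db: "Polynomial.degree (b i) < Polynomial.degree \<phi>" for i
    unfolding a_def b_def by (rule degree_phi_coeff[OF deg])+
  have T_eq: "T k (i, j) = (if k = i + j then a i * b j mod \<phi>
      else if k = Suc (i + j) then a i * b j div \<phi> else 0)" for k i j
  proof -
    have "Polynomial.degree (a i * b j) < 2 * Polynomial.degree \<phi>"
      using da[of i] db[of j] degree_mult_le[of "a i" "b j"] by linarith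
    then show ?thesis unfolding T_def by (simp add: phi_coeff_mult_power[OF deg])
  qed
  have a_ge: "a i \<in> poly_over (val_cball v (\<gamma> - nsmul i \<mu>))"
    and b_ge: "b i \<in> poly_over (val_cball v (\<delta> - nsmul i \<mu>))" for i
    using f g by (auto simp: face_def a_def b_def)
  have split: "\<gamma> + \<delta> - nsmul (i + j) \<mu> = \<gamma> - nsmul i \<mu> + (\<delta> - nsmul j \<mu>)" for i j
    by (simp add: nsmul_plus)
  have ab_ge: "a i * b j \<in> poly_over (val_cball v (\<gamma> + \<delta> - nsmul (i + j) \<mu>))" for i j
    unfolding split by (rule poly_cball_mult[OF a_ge b_ge])
  have T_carry: "T k (i, j) \<in> U k" if "k \<noteq> i + j" for i j k
  proof (cases "k = Suc (i + j)")
    case True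
    have "\<gamma> + \<delta> - nsmul k \<mu> < \<gamma> + \<delta> - nsmul (i + j) \<mu>"
      using \<mu> True by simp
    moreover have "T k (i, j) \<in> poly_over (val_cball v (\<gamma> + \<delta> - nsmul (i + j) \<mu>))"
      using poly_cball_divmod(1)[OF integral_phi monic_phi ab_ge] True by (simp add: T_eq)
    ultimately show ?thesis
      unfolding U_def using poly_over_mono[OF val_cball_subset_oball] by blast
  next
    case False
    then show ?thesis using that subgroup_plus_zero[OF SU] by (simp add: T_eq)
  qed
  have T_ge: "T k x \<in> C k" for k x
  proof (cases x)
    case (Pair i j)
    show ?thesis
    proof (cases "k = i + j")
      case True
      then show ?thesis
        using poly_cball_divmod(2)[OF integral_phi monic_phi ab_ge] by (simp add: Pair T_eq C_def)
    next
      case False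
      then show ?thesis using T_carry UC unfolding Pair by blast
    qed
  qed
  have T_gt: "T k (i, j) \<in> U k" if outside: "k \<noteq> i + j \<or> i < s \<or> S < i \<or> j < s' \<or> S' < j" for k i j
  proof (cases "k = i + j")
    case True
    then consider "i < s \<or> S < i" | "j < s' \<or> S' < j" using outside by blast
    then have "a i * b j \<in> poly_over (val_oball v (\<gamma> + \<delta> - nsmul (i + j) \<mu>))"
    proof cases
      case 1
      then have "a i \<in> poly_over (val_oball v (\<gamma> - nsmul i \<mu>))"
        using f by (auto simp: face_def a_def)
      then show ?thesis unfolding split by (rule poly_oball_mult[OF _ b_ge])
    next
      case 2
      then have "b j \<in> poly_over (val_oball v (\<delta> - nsmul j \<mu>))"
        using g by (auto simp: face_def b_def)
      from poly_oball_mult[OF this a_ge] show ?thesis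
        unfolding split by (simp add: mult.commute add.commute)
    qed
    then show ?thesis
      using poly_oball_divmod(2)[OF integral_phi monic_phi] True by (simp add: T_eq U_def)
  qed (rule T_carry)
  (* the two end points (p, q) = (s, s') and (S, S') satisfy the same three conditions *)
  have extreme: "phi_coeff \<phi> (f * g) (p + q) \<notin> U (p + q)"
    if p: "a p \<notin> poly_over (val_oball v (\<gamma> - nsmul p \<mu>))"
      and q: "b q \<notin> poly_over (val_oball v (\<delta> - nsmul q \<mu>))"
      and rest: "\<And>i j. i + j = p + q \<Longrightarrow> (i, j) \<noteq> (p, q) \<Longrightarrow> i < s \<or> S < i \<or> j < s' \<or> S' < j"
    for p q
  proof
    assume "phi_coeff \<phi> (f * g) (p + q) \<in> U (p + q)"
    moreover have "(p, q) \<in> I"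
      using p q phi_coeff_eq_zero_oball by (auto simp: I_def a_def b_def)
    then have "phi_coeff \<phi> (f * g) (p + q) = T (p + q) (p, q) + (\<Sum>x\<in>I - {(p, q)}. T (p + q) x)"
      unfolding expand by (rule sum.remove[OF finI])
    moreover have "(\<Sum>x\<in>I - {(p, q)}. T (p + q) x) \<in> U (p + q)"
    proof (rule subgroup_plus_sum[OF SU])
      fix x assume "x \<in> I - {(p, q)}"
      then obtain i j where "x = (i, j)" "(i, j) \<noteq> (p, q)" by (cases x) auto
      then show "T (p + q) x \<in> U (p + q)"
        using T_gt[of "p + q" i j] rest[of i j] by (cases "i + j = p + q") auto
    qed
    ultimately have "T (p + q) (p, q) \<in> U (p + q)"
      using subgroup_plus_diff[OF SU] by (metis add_diff_cancel_right')
    moreover have "a p * b q mod \<phi> \<notin> U (p + q)"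
      unfolding U_def split by (rule mult_mod_phi_exact[OF a_ge p da b_ge q db])
    ultimately show False by (simp add: T_eq)
  qed
  have "phi_coeff \<phi> (f * g) k \<in> C k" for k
    unfolding expand by (rule subgroup_plus_sum[OF SC T_ge])
  moreover have "phi_coeff \<phi> (f * g) k \<in> U k" if "k < s + s' \<or> S + S' < k" for k
    unfolding expand
  proof (rule subgroup_plus_sum[OF SU])
    fix x assume "x \<in> I"
    obtain i j where "x = (i, j)" by (cases x)
    then show "T k x \<in> U k"
      using T_gt[of k i j] that by (cases "k = i + j") force+
  qed
  moreover have "phi_coeff \<phi> (f * g) (s + s') \<notin> U (s + s')"
    by (rule extreme) (use f g in \<open>auto simp: face_def a_def b_def\<close>)
  moreover have "phi_coeff \<phi> (f * g) (S + S') \<notin> U (S + S')"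
    by (rule extreme) (use f g in \<open>auto simp: face_def a_def b_def\<close>)
  ultimately show ?thesis
    unfolding face_def C_def U_def by blast
qed

end

context krull_valuation
begin

lemma gauss_val_attained:
  assumes "p \<noteq> 0"
  obtains i where "poly.coeff p i \<noteq> 0" "gauss_val v p = v (poly.coeff p i)"
    "\<And>j. poly.coeff p j \<noteq> 0 \<Longrightarrow> gauss_val v p \<le> v (poly.coeff p j)"
proof -
  define V where "V = (\<lambda>i. v (poly.coeff p i)) ` {i. poly.coeff p i \<noteq> 0}"
  have "finite {i. poly.coeff p i \<noteq> 0}"
    by (rule finite_subset[of _ "{..Polynomial.degree p}"]) (auto intro: le_degree)
  then have fin: "finite V" by (simp add: V_def)
  have "V \<noteq> {}" using assms by (auto simp: V_def poly_eq_iff)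
  then have "gauss_val v p \<in> V" using fin unfolding gauss_val_def V_def[symmetric] by (rule Min_in[rotated])
  moreover have "gauss_val v p \<le> v (poly.coeff p j)" if "poly.coeff p j \<noteq> 0" for j
    unfolding gauss_val_def V_def[symmetric] using that fin by (intro Min_le) (auto simp: V_def)
  ultimately show ?thesis using that by (auto simp: V_def)
qed

lemma poly_over_cball_iff:
  assumes "p \<noteq> 0"
  shows "p \<in> poly_over (val_cball v c) \<longleftrightarrow> c \<le> divcl_embed (gauss_val v p)"
  using gauss_val_attained[OF assms]
  by (smt (verit, best) divcl_embed_le_iff mem_Collect_eq order_trans poly_over_def val_cball_def)

lemma poly_over_oball_iff:
  assumes "p \<noteq> 0"
  shows "p \<in> poly_over (val_oball v c) \<longleftrightarrow> c < divcl_embed (gauss_val v p)"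
  using gauss_val_attained[OF assms]
  by (smt (verit, best) divcl_embed_le_iff mem_Collect_eq less_le_trans poly_over_def val_oball_def)

end

context key_poly
begin

lemma face_exists:
  assumes "f \<noteq> 0"
  obtains \<gamma> s S where "face \<mu> f \<gamma> s S"
proof -
  define I where "I = {i. phi_coeff \<phi> f i \<noteq> 0}"
  define w where "w = (\<lambda>i. divcl_embed (gauss_val v (phi_coeff \<phi> f i)) + nsmul i \<mu>)"
  have fin: "finite I" unfolding I_def by (rule finite_phi_coeff_support[OF degree_phi_pos])
  have "I \<noteq> {}"
  proof
    assume "I = {}"
    then show False
      using phi_expansion_sum[OF degree_phi_pos, of f] assms by (simp add: I_def)
  qed
  then have "Min (w ` I) \<in> w ` I" using fin by simp
  then obtain e where e: "e \<in> I" "Min (w ` I) = w e" by auto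
  have "phi_coeff \<phi> f i \<in> poly_over (val_cball v (w e - nsmul i \<mu>))" for i
  proof (cases "i \<in> I")
    case True
    then have "w e \<le> w i" unfolding e(2)[symmetric] using fin by (intro Min_le) auto
    then show ?thesis
      using True poly_over_cball_iff[of "phi_coeff \<phi> f i"] by (simp add: I_def w_def diff_le_eq)
  next
    case False
    then show ?thesis by (simp add: I_def poly_over_def val_cball_def)
  qed
  moreover have "phi_coeff \<phi> f e \<notin> poly_over (val_oball v (w e - nsmul e \<mu>))"
    using e(1) poly_over_oball_iff[of "phi_coeff \<phi> f e"] by (simp add: I_def w_def)
  ultimately show ?thesis using face_between that by metis
qed

text \<open>
  The coefficient of \<open>\<phi>\<^sup>S\<close> is nonzero, because \<open>0\<close> lies in every open ball.
\<close>

lemma face_degree: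
  assumes "face \<mu> f \<gamma> s S"
  shows "S * Polynomial.degree \<phi> \<le> Polynomial.degree f"
  using degree_ge_phi_coeff_index[OF degree_phi_pos] phi_coeff_eq_zero_oball assms
  unfolding face_def by blast

text \<open>
  Both extremal coefficients have weight \<open>\<gamma>\<close>; subtracting the two equations leaves \<open>(S - s) \<mu>\<close> as a
  difference of values.
\<close>

lemma face_width:
  assumes "face \<mu> f \<gamma> s S"
  shows "nsmul (S - s) \<mu> \<in> divcl_embed ` value_group v"
proof -
  obtain x where x: "x \<noteq> 0" "\<gamma> - nsmul s \<mu> = divcl_embed (v x)"
    using exact_poly_value assms unfolding face_def by metis
  obtain y where y: "y \<noteq> 0" "\<gamma> - nsmul S \<mu> = divcl_embed (v y)"
    using exact_poly_value assms unfolding face_def by metis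
  have "nsmul S \<mu> = nsmul (S - s) \<mu> + nsmul s \<mu>"
    using face_le[OF assms] by (simp flip: nsmul_plus)
  then have "nsmul (S - s) \<mu> = divcl_embed (v x) - divcl_embed (v y)"
    unfolding x(2)[symmetric] y(2)[symmetric] by simp
  also have "\<dots> = divcl_embed (v (x * inverse y))"
    using x y by (simp add: divcl_embed_v_mult v_inverse divcl_embed_uminus)
  finally show ?thesis using x(1) y(1) by (auto simp: value_group_def)
qed

text \<open>
  If \<open>f = g h\<close>, the width \<open>S - s\<close> of \<open>f\<close> is the sum of the widths of \<open>g\<close> and \<open>h\<close>, so one of
  these is positive and belongs to a polynomial of smaller degree.
\<close>

lemma irreducible_factor_with_face:
  assumes \<mu>: "0 < \<mu>" and "f \<noteq> 0" "face \<mu> f \<gamma> s S" "s < S"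
  shows "\<exists>g \<gamma> s S. comm_semiring_1_class.irreducible g \<and> g dvd f \<and> face \<mu> g \<gamma> s S \<and> s < S"
  using assms(2-)
proof (induction "Polynomial.degree f" arbitrary: f \<gamma> s S rule: less_induct)
  case less
  show ?case
  proof (cases "comm_semiring_1_class.irreducible f")
    case True
    then show ?thesis using less.prems dvd_refl by blast
  next
    case False
    have "0 < S * Polynomial.degree \<phi>" using less.prems(3) degree_phi_pos by simp
    then have "0 < Polynomial.degree f" using face_degree[OF less.prems(2)] by linarith
    then have "\<not> f dvd 1" by (simp add: is_unit_iff_degree[OF less.prems(1)])
    then obtain g h where f: "f = g * h" and gh: "\<not> g dvd 1" "\<not> h dvd 1"
      using False less.prems(1) unfolding comm_semiring_1_class.irreducible_def by blast
    have nz: "g \<noteq> 0" "h \<noteq> 0" using less.prems(1) f by auto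
    then have "0 < Polynomial.degree g" "0 < Polynomial.degree h"
      using gh is_unit_iff_degree by auto
    then have deg: "Polynomial.degree g < Polynomial.degree f" "Polynomial.degree h < Polynomial.degree f"
      using nz f by (simp_all add: degree_mult_eq)
    obtain \<gamma>1 s1 S1 where g: "face \<mu> g \<gamma>1 s1 S1" using face_exists[OF nz(1)] .
    obtain \<gamma>2 s2 S2 where h: "face \<mu> h \<gamma>2 s2 S2" using face_exists[OF nz(2)] .
    have "s = s1 + s2 \<and> S = S1 + S2"
      using face_unique[OF less.prems(2)] face_mult[OF \<mu> g h] unfolding f by blast
    then consider "s1 < S1" | "s2 < S2" using less.prems(3) by linarith
    then show ?thesis
    proof cases
      case 1
      from less.hyps[OF deg(1) nz(1) g this] show ?thesis unfolding f by (meson dvd_mult2)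
    next
      case 2
      from less.hyps[OF deg(2) nz(2) h this] show ?thesis unfolding f by (meson dvd_mult)
    qed
  qed
qed

lemma irreducible_factor_degree:
  assumes \<mu>: "0 < \<mu>" and f: "f \<noteq> 0" "face \<mu> f \<gamma> s S" "s < S"
  shows "\<exists>g. comm_semiring_1_class.irreducible g \<and> g dvd f \<and>
    (LEAST e. 0 < e \<and> nsmul e \<mu> \<in> divcl_embed ` value_group v) * Polynomial.degree \<phi>
      \<le> Polynomial.degree g"
proof -
  obtain g \<delta> r R where g: "comm_semiring_1_class.irreducible g" "g dvd f"
    and face: "face \<mu> g \<delta> r R" and "r < R"
    using irreducible_factor_with_face[OF \<mu> f] by blast
  then have "(LEAST e. 0 < e \<and> nsmul e \<mu> \<in> divcl_embed ` value_group v) \<le> R - r"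
    using face_width[OF face] by (intro Least_le) simp
  then have "(LEAST e. 0 < e \<and> nsmul e \<mu> \<in> divcl_embed ` value_group v) * Polynomial.degree \<phi>
      \<le> R * Polynomial.degree \<phi>"
    by (intro mult_le_mono1) simp
  then show ?thesis
    using face_degree[OF face] g order_trans by blast
qed

end

section \<open>Edges of the Newton polygon\<close>

context
  fixes v :: "'k::field \<Rightarrow> 'g::linordered_ab_group_add" and \<phi> f :: "'k poly"
begin

lemma np_indices_le: "i \<in> np_indices \<phi> f \<Longrightarrow> i \<le> phi_length \<phi> f"
  by (simp add: np_indices_def)

text \<open>
  The weight \<open>v\<^sup>x(a\<^sub>e) + e \<mu>\<close> of the point with abscissa \<open>k = n - e\<close>; equivalently, the height at
  abscissa \<open>n\<close> of the line of slope \<open>\<mu>\<close> through this point.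
\<close>

definition np_intercept :: "'g divcl \<Rightarrow> nat \<Rightarrow> 'g divcl" where
  "np_intercept \<mu> k = divcl_embed (np_height v \<phi> f k) + nsmul (phi_length \<phi> f - k) \<mu>"

text \<open>
  Comparing slopes means comparing these heights. Being free of division, the right-hand
  sides are the form in which convexity is used.
\<close>

lemma np_mu_compare:
  assumes "i < k" "k \<le> phi_length \<phi> f"
  shows "\<mu> \<le> np_mu v \<phi> f i k \<longleftrightarrow> np_intercept \<mu> i \<le> np_intercept \<mu> k"
    and "np_mu v \<phi> f i k \<le> \<mu> \<longleftrightarrow> np_intercept \<mu> k \<le> np_intercept \<mu> i"
proof -
  have pos: "0 < k - i" using assms by simp
  have m: "nsmul (k - i) (np_mu v \<phi> f i k) =
      divcl_embed (np_height v \<phi> f k) - divcl_embed (np_height v \<phi> f i)"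
    unfolding np_mu_def nsmul_divcl_frac_cancel[OF pos] by (rule divcl_embed_diff)
  have "phi_length \<phi> f - i = (phi_length \<phi> f - k) + (k - i)" using assms by simp
  then have n: "nsmul (phi_length \<phi> f - i) \<mu> =
      nsmul (phi_length \<phi> f - k) \<mu> + nsmul (k - i) \<mu>"
    by (simp add: nsmul_plus)
  show "\<mu> \<le> np_mu v \<phi> f i k \<longleftrightarrow> np_intercept \<mu> i \<le> np_intercept \<mu> k"
    unfolding nsmul_le_iff[OF pos, of \<mu>, symmetric] m np_intercept_def n
    by (simp add: algebra_simps)
  show "np_mu v \<phi> f i k \<le> \<mu> \<longleftrightarrow> np_intercept \<mu> k \<le> np_intercept \<mu> i"
    unfolding nsmul_le_iff[OF pos, of _ \<mu>, symmetric] m np_intercept_def n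
    by (simp add: algebra_simps)
qed

lemma np_vertex_Suc: "np_vertex v \<phi> f (Suc t) = np_next v \<phi> f (np_vertex v \<phi> f t)"
  by (simp add: np_vertex_def)

context
  assumes deg: "0 < Polynomial.degree \<phi>" and ndvd: "\<not> \<phi> dvd f"
begin

lemma phi_coeff_index_le_length: "phi_coeff \<phi> f i \<noteq> 0 \<Longrightarrow> i \<le> phi_length \<phi> f"
  unfolding phi_length_def by (intro Max_ge finite_phi_coeff_support[OF deg]) simp

lemma phi_coeff_0_nonzero: "phi_coeff \<phi> f 0 \<noteq> 0"
  using ndvd by (auto simp: phi_coeff_eq_div_mod[OF deg])

lemma phi_length_in_np_indices: "phi_length \<phi> f \<in> np_indices \<phi> f"
  using phi_coeff_0_nonzero by (simp add: np_indices_def)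

lemma zero_in_np_indices: "0 \<in> np_indices \<phi> f"
proof -
  have "phi_length \<phi> f \<in> {i. phi_coeff \<phi> f i \<noteq> 0}"
    unfolding phi_length_def
    using phi_coeff_0_nonzero by (intro Max_in finite_phi_coeff_support[OF deg]) blast
  then show ?thesis by (simp add: np_indices_def)
qed

lemma np_next_properties:
  assumes "i \<in> np_indices \<phi> f" "i < phi_length \<phi> f"
  shows "np_next v \<phi> f i \<in> np_indices \<phi> f" "i < np_next v \<phi> f i"
    and "\<And>k. k \<in> np_indices \<phi> f \<Longrightarrow> i < k \<Longrightarrow> np_mu v \<phi> f i (np_next v \<phi> f i) \<le> np_mu v \<phi> f i k"
    and "\<And>k. k \<in> np_indices \<phi> f \<Longrightarrow> np_next v \<phi> f i < k \<Longrightarrow>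
           np_mu v \<phi> f i (np_next v \<phi> f i) < np_mu v \<phi> f i k"
proof -
  define J where "J = {k \<in> np_indices \<phi> f. i < k}"
  define \<mu> where "\<mu> = Min (np_mu v \<phi> f i ` J)"
  define M where "M = {k \<in> np_indices \<phi> f. i < k \<and> np_mu v \<phi> f i k = \<mu>}"
  have next_eq: "np_next v \<phi> f i = Max M"
    by (simp add: np_next_def M_def \<mu>_def J_def)
  have finJ: "finite J"
    by (rule finite_subset[of _ "{..phi_length \<phi> f}"]) (auto simp: J_def dest: np_indices_le)
  have "J \<noteq> {}"
    using phi_length_in_np_indices assms(2) by (auto simp: J_def)
  then have "\<mu> \<in> np_mu v \<phi> f i ` J"
    unfolding \<mu>_def using finJ by (intro Min_in) auto
  then have neM: "M \<noteq> {}" by (auto simp: M_def J_def)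
  have finM: "finite M"
    by (rule finite_subset[OF _ finJ]) (auto simp: M_def J_def)
  have "Max M \<in> M" using finM neM by (rule Max_in)
  then have *: "Max M \<in> np_indices \<phi> f" "i < Max M" "np_mu v \<phi> f i (Max M) = \<mu>"
    by (auto simp: M_def)
  show "np_next v \<phi> f i \<in> np_indices \<phi> f" "i < np_next v \<phi> f i"
    unfolding next_eq by (fact *)+
  show min: "np_mu v \<phi> f i (np_next v \<phi> f i) \<le> np_mu v \<phi> f i k"
    if "k \<in> np_indices \<phi> f" "i < k" for k
    unfolding next_eq * unfolding \<mu>_def using finJ that by (intro Min_le) (auto simp: J_def)
  show "np_mu v \<phi> f i (np_next v \<phi> f i) < np_mu v \<phi> f i k"
    if "k \<in> np_indices \<phi> f" "np_next v \<phi> f i < k" for k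
  proof -
    have "i < k" using that(2) *(2) unfolding next_eq by simp
    moreover have "k \<notin> M" using Max_ge[OF finM, of k] that(2) unfolding next_eq by auto
    ultimately have "np_mu v \<phi> f i k \<noteq> \<mu>" using that(1) by (simp add: M_def)
    then show ?thesis using min[OF that(1) \<open>i < k\<close>] *(3) unfolding next_eq by simp
  qed
qed

text \<open>
  The line that contains an edge lies below all points of the polygon. To the right of the edge
  this is the minimality in the choice of the next vertex. To the left it follows by induction:
  the earlier points lie above the line of the preceding edge, and the slope has grown since then,
  because the next vertex is the last one on that line.
\<close>

lemma np_edge_supports:
  assumes "t < np_edges v \<phi> f"
  shows "np_vertex v \<phi> f t \<in> np_indices \<phi> f \<and> np_vertex v \<phi> f t < phi_length \<phi> f \<and>
    (\<forall>k\<in>np_indices \<phi> f.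
       np_intercept (np_mu v \<phi> f (np_vertex v \<phi> f t) (np_vertex v \<phi> f (Suc t))) (np_vertex v \<phi> f t) \<le>
       np_intercept (np_mu v \<phi> f (np_vertex v \<phi> f t) (np_vertex v \<phi> f (Suc t))) k)"
  using assms
proof (induction t)
  case 0
  have v0: "np_vertex v \<phi> f 0 = 0" by (simp add: np_vertex_def)
  have "np_vertex v \<phi> f 0 \<noteq> phi_length \<phi> f"
    using 0 unfolding np_edges_def by (rule not_less_Least)
  then have less: "0 < phi_length \<phi> f" by (simp add: v0)
  have "np_intercept (np_mu v \<phi> f 0 (np_next v \<phi> f 0)) 0 \<le> np_intercept (np_mu v \<phi> f 0 (np_next v \<phi> f 0)) k"
    if k: "k \<in> np_indices \<phi> f" for k
  proof (cases "k = 0")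
    case False
    then show ?thesis
      using np_next_properties(3)[OF zero_in_np_indices less k]
        np_mu_compare(1)[of 0 k] np_indices_le[OF k] by blast
  qed simp
  then show ?case
    using zero_in_np_indices less by (simp add: v0 np_vertex_Suc)
next
  case (Suc t)
  define i where "i = np_vertex v \<phi> f t"
  define j where "j = np_next v \<phi> f i"
  define j' where "j' = np_next v \<phi> f j"
  define \<mu> where "\<mu> = np_mu v \<phi> f i j"
  define \<mu>' where "\<mu>' = np_mu v \<phi> f j j'"
  have vert: "np_vertex v \<phi> f (Suc t) = j" "np_vertex v \<phi> f (Suc (Suc t)) = j'"
    by (simp_all add: np_vertex_Suc i_def j_def j'_def)
  have i: "i \<in> np_indices \<phi> f" "i < phi_length \<phi> f"
    and supp: "\<And>k. k \<in> np_indices \<phi> f \<Longrightarrow> np_intercept \<mu> i \<le> np_intercept \<mu> k"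
    using Suc.IH Suc.prems vert(1) by (simp_all add: i_def[symmetric] \<mu>_def)
  note j = np_next_properties(1,2)[OF i, folded j_def]
  have "j \<noteq> phi_length \<phi> f"
    unfolding vert(1)[symmetric] using Suc.prems unfolding np_edges_def by (rule not_less_Least)
  then have jn: "j < phi_length \<phi> f" using np_indices_le[OF j(1)] by simp
  note j' = np_next_properties(1,2)[OF j(1) jn, folded j'_def]
  have eq: "np_intercept \<mu> i = np_intercept \<mu> j"
    using np_mu_compare[OF j(2), of \<mu>] jn by (simp add: \<mu>_def)
  have "\<mu> < np_mu v \<phi> f i j'"
    using np_next_properties(4)[OF i j'(1)] j'(2) by (simp add: \<mu>_def j_def)
  then have "np_intercept \<mu> j < np_intercept \<mu> j'"
    using np_mu_compare(2)[of i j' \<mu>] j(2) j' np_indices_le[OF j'(1)] eq by (simp flip: not_le)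
  then have less: "\<mu> < \<mu>'"
    using np_mu_compare(2)[of j j' \<mu>] j' np_indices_le[OF j'(1)] by (simp add: \<mu>'_def flip: not_le)
  have "np_intercept \<mu>' j \<le> np_intercept \<mu>' k" if k: "k \<in> np_indices \<phi> f" for k
  proof (cases k j rule: linorder_cases)
    case less': less
    have "np_mu v \<phi> f k j \<le> \<mu>"
      using np_mu_compare(2)[of k j \<mu>] less' jn supp[OF k] eq by simp
    then have "np_mu v \<phi> f k j \<le> \<mu>'" using less by simp
    then show ?thesis using np_mu_compare(2)[of k j \<mu>'] less' jn by simp
  next
    case greater
    then have "\<mu>' \<le> np_mu v \<phi> f j k"
      using np_next_properties(3)[OF j(1) jn k] by (simp add: \<mu>'_def j'_def)
    then show ?thesis using np_mu_compare(1)[of j k \<mu>'] greater np_indices_le[OF k] by simp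
  qed simp
  then show ?case
    using j(1) jn by (simp add: vert \<mu>'_def)
qed

end

end

text \<open>
  The abscissae run against the exponents, so the right end point \<open>j\<close> of the edge gives the smaller
  exponent \<open>n - j\<close> and the left end point \<open>i\<close> the larger one.
\<close>

lemma (in key_poly) np_slope_face:
  assumes ndvd: "\<not> \<phi> dvd f" and \<mu>: "\<mu> \<in> set (np_slopes v \<phi> f)"
  obtains \<gamma> s S where "face \<mu> f \<gamma> s S" "s < S"
proof -
  note deg = degree_phi_pos
  define n where "n = phi_length \<phi> f"
  define H where "H = np_intercept v \<phi> f \<mu>"
  obtain t where t: "t < np_edges v \<phi> f"
    and \<mu>_eq: "\<mu> = np_mu v \<phi> f (np_vertex v \<phi> f t) (np_vertex v \<phi> f (Suc t))"
    using \<mu> by (auto simp: np_slopes_def)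
  define i where "i = np_vertex v \<phi> f t"
  define j where "j = np_next v \<phi> f i"
  have \<mu>_ij: "\<mu> = np_mu v \<phi> f i j"
    unfolding \<mu>_eq by (simp add: i_def j_def np_vertex_Suc)
  have i: "i \<in> np_indices \<phi> f" "i < n"
    and supp: "\<And>k. k \<in> np_indices \<phi> f \<Longrightarrow> H i \<le> H k"
    using np_edge_supports[OF deg ndvd t] unfolding \<mu>_eq[symmetric] by (simp_all add: i_def n_def H_def)
  have j: "j \<in> np_indices \<phi> f" "i < j" "j \<le> n"
    using np_next_properties(1,2)[OF deg ndvd i(1), of v] i(2) np_indices_le
    by (simp_all add: j_def n_def np_indices_def)
  have eq: "H i = H j"
    using np_mu_compare[OF j(2), where v = v and \<phi> = \<phi> and f = f and \<mu> = \<mu>] j(3) by (simp add: H_def n_def \<mu>_ij)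
  have H: "divcl_embed (gauss_val v (phi_coeff \<phi> f (n - k))) = H k - nsmul (n - k) \<mu>" for k
    by (simp add: H_def np_intercept_def np_height_def n_def)
  have "phi_coeff \<phi> f e \<in> poly_over (val_cball v (H i - nsmul e \<mu>))" for e
  proof (cases "phi_coeff \<phi> f e = 0")
    case True
    then show ?thesis by (simp add: poly_over_def val_cball_def)
  next
    case False
    then have "e \<le> n"
      unfolding n_def by (rule phi_coeff_index_le_length[OF deg ndvd])
    then have "n - e \<in> np_indices \<phi> f" and e: "n - (n - e) = e"
      using False by (simp_all add: np_indices_def n_def)
    then show ?thesis
      using supp[of "n - e"] H[of "n - e"] False by (simp add: poly_over_cball_iff)
  qed
  moreover have "phi_coeff \<phi> f (n - k) \<notin> poly_over (val_oball v (H i - nsmul (n - k) \<mu>))"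
    if "k \<in> np_indices \<phi> f" "H k = H i" for k
    using that H[of k] by (simp add: np_indices_def n_def poly_over_oball_iff)
  ultimately obtain s S where "face \<mu> f (H i) s S" "s \<le> n - j" "n - i \<le> S"
    using face_between i(1) j(1) eq by metis
  moreover have "n - j < n - i" using i(2) j(2) by simp
  ultimately show ?thesis using that by fastforce
qed

theorem theorem1p3:
  fixes v :: "'k::field \<Rightarrow> 'g::linordered_ab_group_add"
    and \<phi> f :: "'k poly"
    and m l :: nat
    and lam :: "nat \<Rightarrow> 'g divcl"
    and d :: "nat \<Rightarrow> nat"
  assumes "krull_valuation v"
    and "integral_poly v \<phi>"
    and "lead_coeff \<phi> = 1"
    and "Polynomial.degree \<phi> = m"
    and "ring_irreducible\<^bsub>UP (residue_field v)\<^esub> (reduce_poly v \<phi>)"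
    and "integral_poly v f"
    and "\<not> \<phi> dvd f"
    and "np_positive_slopes v \<phi> f = map lam [1..<l + 1]"
    and "l \<ge> 1"
    and "\<And>j. 1 \<le> j \<Longrightarrow> j \<le> l \<Longrightarrow>
           d j = (LEAST e. 0 < e \<and> nsmul e (lam j) \<in> divcl_embed ` value_group v)"
  shows "\<exists>g. comm_semiring_1_class.irreducible g \<and> g dvd f \<and>
           Polynomial.degree g \<ge> (MAX j\<in>{1..l}. d j * m)"
proof -
  interpret key_poly v \<phi>
    using assms(1-3,5) by (simp add: key_poly_def key_poly_axioms_def)
  have "(MAX j\<in>{1..l}. d j * m) \<in> (\<lambda>j. d j * m) ` {1..l}"
    using \<open>l \<ge> 1\<close> by (intro Max_in) auto
  then obtain j where j: "1 \<le> j" "j \<le> l" and max: "(MAX j\<in>{1..l}. d j * m) = d j * m"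
    by auto
  have "j \<in> set [1..<l + 1]"
    using j by auto
  then have "lam j \<in> set (map lam [1..<l + 1])"
    unfolding set_map by (rule imageI)
  then have slope: "lam j \<in> set (np_slopes v \<phi> f)" and pos: "0 < lam j"
    unfolding assms(8)[symmetric] by (auto simp: np_positive_slopes_def)
  obtain \<gamma> s S where face: "face (lam j) f \<gamma> s S" "s < S"
    using np_slope_face[OF assms(7) slope] .
  have "f \<noteq> 0"
    using assms(7) by auto
  from irreducible_factor_degree[OF pos this face] show ?thesis
    unfolding max assms(4) assms(10)[OF j] by blast
qed

end
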